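(* Let $\widehat{\mathfrak g}$ be an affine Kac--Moody algebra over $\mathbb C$ (untwisted or twisted). Then the vector space of all Hom-Lie structures on $\widehat{\mathfrak g}$ is linearly spanned by the central Hom-Lie structures on $\widehat{\mathfrak g}$ and the identity map $\mathrm{id}_{\widehat{\mathfrak g}}$.
   Context: A Hom-Lie structure on a Lie algebra $L$ is a linear map $\varphi: L\to L$ such that $[[x,y],\varphi(z)]+[[z,x],\varphi(y)]+[[y,z],\varphi(x)]=0$ for all $x,y,z\in L$. The Hom-Lie structures on $L$ form a vector subspace of $\mathrm{End}(L)$. Any linear map from $L$ to its center $\mathrm{Z}(L)$ is a Hom-Lie structure on $L$; such Hom-Lie structures are called central. Affine Kac--Moody algebras are realized as follows. Let $\mathfrak g$ be a finite-dimensional simple complex Lie algebra. Either $n=1$ (untwisted case, with the trivial grading $\mathfrak g=\mathfrak g_{\overline 0}$), or $n\in\{2,3\}$ (twisted case) and $\mathfrak g=\bigoplus_{\overline i\in\mathbb Z/n\mathbb Z}\mathfrak g_{\overline i}$ is the $\mathbb Z/n\mathbb Z$-grading of $\mathfrak g$ by eigenspaces of a diagram automorphism of $\mathfrak g$ of order $n$. Put $\mathscr L(\mathfrak g,n)=\bigoplus_{i\in\mathbb Z}\mathfrak g_{i \bmod n}\otimes t^i\subseteq \mathfrak g\otimes\mathbb C[t,t^{-1}]$. As a vector space, $$\widehat{\mathfrak g}=\mathscr L(\mathfrak g,n)\oplus\mathbb C d\oplus\mathbb C z,\qquad d=\mathrm{id}_{\mathfrak g}\otimes t\tfrac{\mathrm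 d}{\mathrm dt},$$ where $z$ is central, $[d,x\otimes t^i]=i\,x\otimes t^i$, and $[x\otimes t^i,y\otimes t^j]=[x,y]\otimes t^{i+j}+i\,\delta_{i+j,0}\langle x,y\rangle z$, with $\langle\cdot,\cdot\rangle$ the Killing form of $\mathfrak g$ (the cocycle being the Kac--Moody $2$-cocycle, up to a nonzero scalar). *)

theory Defs
  imports
    Complex_Main
    "HOL-Library.Poly_Mapping"
    "HOL-Library.Product_Plus"
    "HOL-Library.Function_Algebras"
    "HOL-Combinatorics.Permutations"
begin

section \<open>Lie algebras and Hom-Lie structures\<close>

text \<open>The Lie algebra is a subspace L of an ambient vector space, because twisted loop algebras
  arise as subspaces of a type of Laurent polynomials that depend on term-level data.\<close>

locale lie_algebra = vector_space scale
  for scale :: "'k::field \<Rightarrow> 'v::ab_group_add \<Rightarrow> 'v" +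
  fixes L :: "'v set"
    and bracket :: "'v \<Rightarrow> 'v \<Rightarrow> 'v"
  assumes subspace_carrier: "subspace L"
    and bracket_closed: "\<lbrakk>x \<in> L; y \<in> L\<rbrakk> \<Longrightarrow> bracket x y \<in> L"
    and bracket_add_left:
      "\<lbrakk>x \<in> L; y \<in> L; z \<in> L\<rbrakk> \<Longrightarrow> bracket (x + y) z = bracket x z + bracket y z"
    and bracket_add_right:
      "\<lbrakk>x \<in> L; y \<in> L; z \<in> L\<rbrakk> \<Longrightarrow> bracket x (y + z) = bracket x y + bracket x z"
    and bracket_scale_left: "\<lbrakk>x \<in> L; y \<in> L\<rbrakk> \<Longrightarrow> bracket (scale c x) y = scale c (bracket x y)"
    and bracket_scale_right: "\<lbrakk>x \<in> L; y \<in> L\<rbrakk> \<Longrightarrow> bracket x (scale c y) = scale c (bracket x y)"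
    and bracket_self: "x \<in> L \<Longrightarrow> bracket x x = 0"
    and jacobi: "\<lbrakk>x \<in> L; y \<in> L; z \<in> L\<rbrakk> \<Longrightarrow>
      bracket (bracket x y) z + bracket (bracket y z) x + bracket (bracket z x) y = 0"
begin

definition center :: "'v set" where
  "center = {x \<in> L. \<forall>y\<in>L. bracket x y = 0}"

definition subalgebra :: "'v set \<Rightarrow> bool" where
  "subalgebra S \<longleftrightarrow> S \<subseteq> L \<and> subspace S \<and> (\<forall>x\<in>S. \<forall>y\<in>S. bracket x y \<in> S)"

definition ideal :: "'v set \<Rightarrow> bool" where
  "ideal I \<longleftrightarrow> I \<subseteq> L \<and> subspace I \<and> (\<forall>x\<in>L. \<forall>y\<in>I. bracket x y \<in> I)"

definition simple :: bool where
  "simple \<longleftrightarrow> (\<exists>x\<in>L. \<exists>y\<in>L. bracket x y \<noteq> 0) \<and> (\<forall>I. ideal I \<longrightarrow> I = {0} \<or> I = L)"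

text \<open>A linear endomorphism of L is represented by its extension by 0 to the ambient type, so
  that distinct functions in \<open>endomorphisms\<close> are distinct endomorphisms of L.\<close>

definition endomorphisms :: "('v \<Rightarrow> 'v) set" where
  "endomorphisms = {\<phi>. (\<forall>x\<in>L. \<phi> x \<in> L) \<and>
    (\<forall>x\<in>L. \<forall>y\<in>L. \<phi> (x + y) = \<phi> x + \<phi> y) \<and>
    (\<forall>c. \<forall>x\<in>L. \<phi> (scale c x) = scale c (\<phi> x)) \<and>
    (\<forall>x. x \<notin> L \<longrightarrow> \<phi> x = 0)}"

definition identity_map :: "'v \<Rightarrow> 'v" where
  "identity_map = (\<lambda>x. if x \<in> L then x else 0)"

definition hom_lie_structures :: "('v \<Rightarrow> 'v) set" where
  "hom_lie_structures = {\<phi> \<in> endomorphisms. \<forall>x\<in>L. \<forall>y\<in>L. \<forall>z\<in>L.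
    bracket (bracket x y) (\<phi> z) + bracket (bracket z x) (\<phi> y) + bracket (bracket y z) (\<phi> x) = 0}"

definition central_hom_lie_structures :: "('v \<Rightarrow> 'v) set" where
  "central_hom_lie_structures = {\<phi> \<in> hom_lie_structures. \<forall>x\<in>L. \<phi> x \<in> center}"

definition map_span :: "('v \<Rightarrow> 'v) set \<Rightarrow> ('v \<Rightarrow> 'v) set" where
  "map_span = module.span (\<lambda>c \<phi> x. scale c (\<phi> x))"

end


section \<open>Finite-dimensional Lie algebras, Killing form, diagram automorphisms\<close>

locale finite_dimensional_lie_algebra =
  finite_dimensional_vector_space scale Basis + lie_algebra scale UNIV bracket
  for scale :: "complex \<Rightarrow> 'a::ab_group_add \<Rightarrow> 'a"
    and Basis :: "'a set"
    and bracket :: "'a \<Rightarrow> 'a \<Rightarrow> 'a"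
begin

definition endo_trace :: "('a \<Rightarrow> 'a) \<Rightarrow> complex" where
  "endo_trace f = (\<Sum>b\<in>Basis. representation Basis (f b) b)"

definition killing :: "'a \<Rightarrow> 'a \<Rightarrow> complex" where
  "killing x y = endo_trace (bracket x \<circ> bracket y)"

definition lie_automorphism :: "('a \<Rightarrow> 'a) \<Rightarrow> bool" where
  "lie_automorphism \<sigma> \<longleftrightarrow> Vector_Spaces.linear scale scale \<sigma> \<and> bij \<sigma> \<and>
    (\<forall>x y. \<sigma> (bracket x y) = bracket (\<sigma> x) (\<sigma> y))"

text \<open>Linear independence of the \<open>h i\<close> is essential: without it the generators of a loop algebra,
  evaluated at t = 1, would qualify with an affine Cartan matrix.  For a simple algebra it forces
  A to be invertible (a kernel vector of A gives a central element), so that the \<open>h i\<close> span a Cartan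
  subalgebra, the \<open>e i\<close> are root vectors for a base of the root system, and A is its Cartan
  matrix.\<close>

definition chevalley_generators ::
    "nat \<Rightarrow> (nat \<Rightarrow> nat \<Rightarrow> int) \<Rightarrow> (nat \<Rightarrow> 'a) \<Rightarrow> (nat \<Rightarrow> 'a) \<Rightarrow> (nat \<Rightarrow> 'a) \<Rightarrow> bool" where
  "chevalley_generators r A e h f \<longleftrightarrow>
    (\<forall>i<r. A i i = 2) \<and>
    (\<forall>i<r. \<forall>j<r. i \<noteq> j \<longrightarrow> A i j \<le> 0 \<and> (A i j = 0 \<longleftrightarrow> A j i = 0)) \<and>
    inj_on h {..<r} \<and> independent (h ` {..<r}) \<and>
    (\<forall>i<r. \<forall>j<r. bracket (h i) (h j) = 0 \<and>
      bracket (h i) (e j) = scale (of_int (A i j)) (e j) \<and>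
      bracket (h i) (f j) = scale (- of_int (A i j)) (f j) \<and>
      bracket (e i) (f j) = (if i = j then h i else 0)) \<and>
    (\<forall>S. subalgebra S \<and> e ` {..<r} \<subseteq> S \<and> f ` {..<r} \<subseteq> S \<longrightarrow> S = UNIV)"

definition diagram_automorphism :: "('a \<Rightarrow> 'a) \<Rightarrow> bool" where
  "diagram_automorphism \<sigma> \<longleftrightarrow> lie_automorphism \<sigma> \<and>
    (\<exists>r A e h f p. chevalley_generators r A e h f \<and> p permutes {..<r} \<and>
      (\<forall>i<r. \<forall>j<r. A (p i) (p j) = A i j) \<and>
      (\<forall>i<r. \<sigma> (e i) = e (p i) \<and> \<sigma> (f i) = f (p i)))"

definition has_order :: "('a \<Rightarrow> 'a) \<Rightarrow> nat \<Rightarrow> bool" where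
  "has_order \<sigma> n \<longleftrightarrow> n > 0 \<and> \<sigma> ^^ n = id \<and> (\<forall>m. 0 < m \<and> m < n \<longrightarrow> \<sigma> ^^ m \<noteq> id)"

definition affine_grading :: "nat \<Rightarrow> (int \<Rightarrow> 'a set) \<Rightarrow> bool" where
  "affine_grading n G \<longleftrightarrow>
    (n = 1 \<and> (\<forall>k. G k = UNIV)) \<or>
    (n \<in> {2, 3} \<and> (\<exists>\<sigma>. diagram_automorphism \<sigma> \<and> has_order \<sigma> n \<and>
      (\<forall>k. G k = {x. \<sigma> x = scale (cis (2 * pi * of_int k / of_nat n)) x})))"


section \<open>The affine Kac-Moody algebra\<close>

text \<open>A triple \<open>(u, a, c)\<close> stands for \<open>u + a d + c z\<close>; the finitely supported map \<open>u\<close> stands for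
  the sum over all i of \<open>lookup u i\<close> tensor the i-th power of t.\<close>

definition affine_carrier ::
    "nat \<Rightarrow> (int \<Rightarrow> 'a set) \<Rightarrow> ((int \<Rightarrow>\<^sub>0 'a) \<times> complex \<times> complex) set" where
  "affine_carrier n G = {(u, a, c). \<forall>i. Poly_Mapping.lookup u i \<in> G (i mod int n)}"

definition loop_scale :: "complex \<Rightarrow> (int \<Rightarrow>\<^sub>0 'a) \<Rightarrow> (int \<Rightarrow>\<^sub>0 'a)" where
  "loop_scale c u = Poly_Mapping.map (scale c) u"

definition loop_bracket :: "(int \<Rightarrow>\<^sub>0 'a) \<Rightarrow> (int \<Rightarrow>\<^sub>0 'a) \<Rightarrow> (int \<Rightarrow>\<^sub>0 'a)" where
  "loop_bracket u v = (\<Sum>i\<in>Poly_Mapping.keys u. \<Sum>j\<in>Poly_Mapping.keys v.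
     Poly_Mapping.single (i + j) (bracket (Poly_Mapping.lookup u i) (Poly_Mapping.lookup v j)))"

definition loop_derivation :: "(int \<Rightarrow>\<^sub>0 'a) \<Rightarrow> (int \<Rightarrow>\<^sub>0 'a)" where
  "loop_derivation u = (\<Sum>i\<in>Poly_Mapping.keys u.
     Poly_Mapping.single i (scale (of_int i) (Poly_Mapping.lookup u i)))"

definition loop_cocycle :: "(int \<Rightarrow>\<^sub>0 'a) \<Rightarrow> (int \<Rightarrow>\<^sub>0 'a) \<Rightarrow> complex" where
  "loop_cocycle u v = (\<Sum>i\<in>Poly_Mapping.keys u. \<Sum>j\<in>Poly_Mapping.keys v.
     if i + j = 0 then of_int i * killing (Poly_Mapping.lookup u i) (Poly_Mapping.lookup v j) else 0)"

definition affine_scale ::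
    "complex \<Rightarrow> (int \<Rightarrow>\<^sub>0 'a) \<times> complex \<times> complex \<Rightarrow> (int \<Rightarrow>\<^sub>0 'a) \<times> complex \<times> complex" where
  "affine_scale k = (\<lambda>(u, a, c). (loop_scale k u, k * a, k * c))"

definition affine_bracket ::
    "(int \<Rightarrow>\<^sub>0 'a) \<times> complex \<times> complex \<Rightarrow> (int \<Rightarrow>\<^sub>0 'a) \<times> complex \<times> complex \<Rightarrow>
     (int \<Rightarrow>\<^sub>0 'a) \<times> complex \<times> complex" where
  "affine_bracket = (\<lambda>(u, a, c) (v, b, e).
     (loop_bracket u v + loop_scale a (loop_derivation v) - loop_scale b (loop_derivation u),
      0, loop_cocycle u v))"

end

end

theory Submission
  imports Defs
begin

text \<open>Let D be the fixed-point algebra in degree 0. The only structural fact needed about the grading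
  is that nothing but 0 in the simple algebra commutes with [D, D].

  Subtract from a Hom-Lie structure \<open>\<phi>\<close> the multiple of the identity that kills the d-component of
  \<open>\<phi> d\<close>; let w be the loop component of what is left of \<open>\<phi> d\<close>. Writing the Hom-Lie identity for d,
  x in D of degree i (a multiple of the period) and y in D of degree 0 yields an expression quadratic
  in i, so [[x, y], w] and [x, \<open>\<phi>\<close> y] vanish, whence w = 0 and \<open>\<phi>\<close> y is central. The identity for x, y
  in D of degree 0 and an arbitrary homogeneous z then reads [[x, y], \<open>\<phi>\<close> z] = 0, so \<open>\<phi>\<close> z has no loop
  component, and the identity with d shows that it has no d-component either.

  In the twisted case let H in the span of the \<open>h i\<close> satisfy \<open>[H, e j] = e j\<close> for all j; it exists since
  the Cartan matrix is invertible and is fixed by the automorphism by uniqueness. It and the orbit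
  sums E of the \<open>e j\<close> lie in [D, D]. The centralizer of H is the span of the \<open>h i\<close>, and an element
  of that span commuting with all the E is central in the simple algebra, hence 0.\<close>

section \<open>Finitely supported maps and interpolation in vector spaces\<close>

abbreviation "lookup \<equiv> Poly_Mapping.lookup"
abbreviation "single \<equiv> Poly_Mapping.single"

lemma poly_mapping_eq_sum_single:
  "(\<Sum>i\<in>Poly_Mapping.keys u. single i (lookup u i)) = (u :: 'b \<Rightarrow>\<^sub>0 'a::comm_monoid_add)"
  by (rule poly_mapping_eqI) (auto simp: lookup_sum lookup_single when_def sum.delta in_keys_iff)

text \<open>A finitely supported map is a finite sum of monomials, so an additive statement about
  loops only has to be checked on monomials; nested use settles bilinear and trilinear
  identities.\<close>

lemma poly_mapping_add_induct [case_names zero single add]: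
  fixes u :: "'b \<Rightarrow>\<^sub>0 'a::comm_monoid_add"
  assumes "P 0" "\<And>i x. P (single i x)" "\<And>u v. P u \<Longrightarrow> P v \<Longrightarrow> P (u + v)"
  shows "P u"
proof -
  have "P (\<Sum>i\<in>I. single i (lookup u i))" if "finite I" for I
    using that by induction (auto intro: assms)
  from this [OF finite_keys, of u] show ?thesis
    by (simp add: poly_mapping_eq_sum_single)
qed

lemma (in vector_space) scale_numeral_eq:
  "scale 2 x = x + x" "scale 3 x = x + x + x" "scale 4 x = x + x + x + x"
  "scale 9 x = x + x + x + x + x + x + x + x + x"
proof -
  have "scale (1 + 1) x = x + x" "scale (1 + 1 + 1) x = x + x + x" "scale (1 + 1 + 1 + 1) x = x + x + x + x"
    "scale (1 + 1 + 1 + 1 + 1 + 1 + 1 + 1 + 1) x = x + x + x + x + x + x + x + x + x"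
    by (simp_all only: scale_left_distrib scale_one)
  then show "scale 2 x = x + x" "scale 3 x = x + x + x" "scale 4 x = x + x + x + x"
    "scale 9 x = x + x + x + x + x + x + x + x + x"
    by simp_all
qed

lemma (in vector_space) add_self_eq_0D:
  fixes x :: 'b
  assumes "x + x = 0" "(2 :: 'a) \<noteq> 0"
  shows "x = 0"
proof -
  have "scale 2 x = 0"
    using assms(1) by (simp add: scale_numeral_eq)
  with assms(2) show ?thesis
    by simp
qed

text \<open>Interpolation with vector coefficients: the Vandermonde determinant at 1, 2, 3 equals 2.
  The factors \<open>t\<close> and \<open>t'\<close> allow the sample points to be multiples of a
  period.\<close>

lemma (in vector_space) quadratic_coefficients_eq_0:
  assumes "\<And>s. s \<in> {1, 2, 3} \<Longrightarrow> a + scale (s * t) b + scale (s * s * t') c = 0"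
    and "(2 :: 'a) \<noteq> 0" "t \<noteq> 0" "t' \<noteq> 0"
  shows "a = 0 \<and> b = 0 \<and> c = 0"
proof -
  define B where "B = scale t b"
  define C where "C = scale t' c"
  have e1: "a + B + C = 0"
    using assms(1) [of 1] by (simp add: B_def C_def)
  have e2: "a + scale 2 B + scale 4 C = 0"
    using assms(1) [of 2] by (simp add: B_def C_def)
  have e3: "a + scale 3 B + scale 9 C = 0"
    using assms(1) [of 3] by (simp add: B_def C_def)
  have "(a + scale 2 B + scale 4 C) - (a + B + C) = 0"
    unfolding e1 e2 by simp
  then have B: "B = - scale 3 C"
    unfolding scale_numeral_eq eq_neg_iff_add_eq_0 by (simp add: algebra_simps)
  have "a + B + C = a - scale 2 C"
    unfolding B by (simp add: scale_numeral_eq algebra_simps)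
  with e1 have a: "a = scale 2 C"
    by simp
  have "C + C = 0"
    using e3 unfolding B a by (simp add: scale_numeral_eq algebra_simps)
  then have C: "C = 0"
    using add_self_eq_0D assms(2) by blast
  with a B assms(3,4) show ?thesis
    by (simp add: B_def C_def)
qed

section \<open>Loop algebras\<close>

context finite_dimensional_lie_algebra
begin

section \<open>Bracket calculus\<close>

lemma bracket_add [simp]:
  "bracket (x + y) z = bracket x z + bracket y z"
  "bracket x (y + z) = bracket x y + bracket x z"
  using bracket_add_left bracket_add_right by auto

lemma bracket_scale [simp]:
  "bracket (scale c x) y = scale c (bracket x y)"
  "bracket x (scale c y) = scale c (bracket x y)"
  using bracket_scale_left bracket_scale_right by auto

lemma bracket_same [simp]: "bracket x x = 0"
  using bracket_self by auto

lemma bracket_zero [simp]: "bracket 0 x = 0" "bracket x 0 = 0"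
  using bracket_scale(1) [of 0 x x] bracket_scale(2) [of x 0 x] by auto

lemma bracket_uminus [simp]: "bracket (- x) y = - bracket x y" "bracket x (- y) = - bracket x y"
  using bracket_scale(1) [of "-1" x y] bracket_scale(2) [of x "-1" y] by auto

lemma bracket_diff [simp]:
  "bracket (x - y) z = bracket x z - bracket y z"
  "bracket x (y - z) = bracket x y - bracket x z"
  using bracket_add(1) [of x "- y" z] bracket_add(2) [of x y "- z"] by auto

lemma bracket_sum_left: "bracket (sum f I) x = (\<Sum>i\<in>I. bracket (f i) x)"
  by (induction I rule: infinite_finite_induct) auto

lemma bracket_sum_right: "bracket x (sum f I) = (\<Sum>i\<in>I. bracket x (f i))"
  by (induction I rule: infinite_finite_induct) auto

lemma bracket_commute: "bracket x y = - bracket y x"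
  using bracket_same [of "x + y"] unfolding bracket_add by (simp add: eq_neg_iff_add_eq_0 add.commute)

lemma bracket_bracket_left:
  "bracket (bracket x y) z = bracket x (bracket y z) - bracket y (bracket x z)"
  using jacobi [of x y z] bracket_commute [of "bracket y z" x] bracket_commute [of "bracket z x" y]
    bracket_commute [of z x] bracket_commute [of y "bracket x z"]
  by (simp add: algebra_simps)

section \<open>Trace and Killing form\<close>

lemma representation_Basis:
  "representation Basis (x + y) b = representation Basis x b + representation Basis y b"
  "representation Basis (scale c x) b = c * representation Basis x b"
  "representation Basis (\<Sum>i\<in>I. f i) b = (\<Sum>i\<in>I. representation Basis (f i) b)"
  using representation_add [OF independent_Basis] representation_scale [OF independent_Basis]
    representation_sum [OF independent_Basis, of I f] span_Basis by auto

text \<open>In coordinates either trace is the double sum of products of matrix entries; the two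
  differ only in the order of summation.\<close>

lemma endo_trace_commute:
  assumes "Vector_Spaces.linear scale scale f" "Vector_Spaces.linear scale scale g"
  shows "endo_trace (f \<circ> g) = endo_trace (g \<circ> f)"
proof -
  define R where "R = representation Basis"
  have *: "endo_trace (f \<circ> g) = (\<Sum>b\<in>Basis. \<Sum>c\<in>Basis. R (g b) c * R (f c) b)"
    if "Vector_Spaces.linear scale scale f" for f g
  proof -
    interpret f: Vector_Spaces.linear scale scale f by fact
    have "R (f x) b = (\<Sum>c\<in>Basis. R x c * R (f c) b)" for x b
    proof -
      have "f x = f (\<Sum>c\<in>Basis. scale (R x c) c)"
        unfolding R_def
        by (subst sum_representation_eq) (use independent_Basis span_Basis finite_Basis in auto)
      also have "\<dots> = (\<Sum>c\<in>Basis. scale (R x c) (f c))"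
        by (simp add: f.sum f.scale)
      finally show ?thesis
        unfolding R_def
        by (simp add: representation_Basis)
    qed
    then show ?thesis
      unfolding endo_trace_def comp_def R_def [symmetric] by (intro sum.cong refl)
  qed
  show ?thesis
    unfolding * [OF assms(1)] * [OF assms(2)] by (subst sum.swap) (simp add: mult.commute)
qed

lemma endo_trace_add: "endo_trace (\<lambda>x. f x + g x) = endo_trace f + endo_trace g"
  by (simp add: endo_trace_def representation_Basis sum.distrib)

lemma endo_trace_scale: "endo_trace (\<lambda>x. scale c (f x)) = c * endo_trace f"
  by (simp add: endo_trace_def sum_distrib_left representation_Basis)

lemma endo_trace_diff: "endo_trace (\<lambda>x. f x - g x) = endo_trace f - endo_trace g"
  using endo_trace_add [of f "\<lambda>x. scale (-1) (g x)"] endo_trace_scale [of "-1" g] by simp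

lemma linear_ad: "Vector_Spaces.linear scale scale (bracket x)"
  by unfold_locales auto

lemma killing_commute: "killing x y = killing y x"
  unfolding killing_def by (intro endo_trace_commute linear_ad)

lemma killing_add [simp]:
  "killing (x + y) z = killing x z + killing y z"
  "killing x (y + z) = killing x y + killing x z"
  by (simp_all add: killing_def comp_def endo_trace_add)

lemma killing_scale [simp]:
  "killing (scale c x) y = c * killing x y" "killing x (scale c y) = c * killing x y"
  by (simp_all add: killing_def comp_def endo_trace_scale)

lemma killing_zero [simp]: "killing 0 x = 0" "killing x 0 = 0"
  using killing_scale(1) [of 0 x x] killing_scale(2) [of x 0 x] by simp_all

lemma killing_uminus [simp]: "killing (- x) y = - killing x y" "killing x (- y) = - killing x y"
  using killing_scale(1) [of "-1" x y] killing_scale(2) [of x "-1" y] by simp_all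

text \<open>Since ad [x, y] is the commutator of ad x and ad y, cyclicity of the trace moves the
  bracket from one argument to the other. The cyclic form matches the three terms of the cocycle
  identity.\<close>

lemma killing_invariant: "killing (bracket x y) z = killing (bracket y z) x"
proof -
  have lin: "Vector_Spaces.linear scale scale (bracket x \<circ> bracket z)"
    by unfold_locales auto
  have "endo_trace ((bracket x \<circ> bracket z) \<circ> bracket y) = endo_trace (bracket y \<circ> (bracket x \<circ> bracket z))"
    by (rule endo_trace_commute [OF lin linear_ad])
  then have "killing (bracket x y) z = killing x (bracket y z)"
    by (simp add: killing_def comp_def bracket_bracket_left endo_trace_diff)
  then show ?thesis
    by (simp add: killing_commute)
qed

section \<open>Linearity of the loop operations and their values on monomials\<close>

lemma lookup_loop_scale [simp]: "lookup (loop_scale c u) i = scale c (lookup u i)"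
  by (simp add: loop_scale_def Poly_Mapping.map.rep_eq when_def)

lemma lookup_loop_derivation [simp]: "lookup (loop_derivation u) i = scale (of_int i) (lookup u i)"
  by (auto simp: loop_derivation_def lookup_sum lookup_single when_def sum.delta in_keys_iff)

text \<open>Cancellation may shrink the key set of a sum; this is harmless because the summand is
  additive in the coefficient and vanishes at 0.\<close>

lemma loop_bracket_add_left: "loop_bracket (u + u') v = loop_bracket u v + loop_bracket u' v"
  unfolding loop_bracket_def
  by (rule setsum_keys_plus_distrib [where f =
      "\<lambda>i x. \<Sum>j\<in>Poly_Mapping.keys v.
        single (i + j) (bracket x (lookup v j))"])
    (simp_all add: single_add sum.distrib)

lemma loop_bracket_add_right: "loop_bracket u (v + v') = loop_bracket u v + loop_bracket u v'"
  unfolding loop_bracket_def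
  \<comment> \<open>Exchanging the sums makes the argument under consideration the outer
    one.\<close>
  by (subst (1 2 3) sum.swap,
    rule setsum_keys_plus_distrib [where f =
      "\<lambda>j x. \<Sum>i\<in>Poly_Mapping.keys u.
        single (i + j) (bracket (lookup u i) x)"])
    (simp_all add: single_add sum.distrib)

lemma loop_cocycle_add_left: "loop_cocycle (u + u') v = loop_cocycle u v + loop_cocycle u' v"
  unfolding loop_cocycle_def
  by (rule setsum_keys_plus_distrib [where f =
      "\<lambda>i x. \<Sum>j\<in>Poly_Mapping.keys v.
        if i + j = 0 then of_int i * killing x (lookup v j) else 0"])
    (auto simp flip: sum.distrib simp: algebra_simps intro!: sum.cong sum.neutral)

lemma loop_cocycle_add_right: "loop_cocycle u (v + v') = loop_cocycle u v + loop_cocycle u v'"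
  unfolding loop_cocycle_def
  by (subst (1 2 3) sum.swap,
    rule setsum_keys_plus_distrib [where f =
      "\<lambda>j x. \<Sum>i\<in>Poly_Mapping.keys u.
        if i + j = 0 then of_int i * killing (lookup u i) x else 0"])
    (auto simp flip: sum.distrib simp: algebra_simps intro!: sum.cong sum.neutral)

lemma loop_bracket_single [simp]: "loop_bracket (single i x) (single j y) = single (i + j) (bracket x y)"
  by (simp add: loop_bracket_def)

lemma loop_cocycle_single [simp]:
  "loop_cocycle (single i x) (single j y) = (if i + j = 0 then of_int i * killing x y else 0)"
  by (simp add: loop_cocycle_def)

lemma loop_bracket_zero [simp]: "loop_bracket 0 u = 0" "loop_bracket u 0 = 0"
  by (simp_all add: loop_bracket_def)

lemma loop_cocycle_zero [simp]: "loop_cocycle 0 u = 0" "loop_cocycle u 0 = 0"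
  by (simp_all add: loop_cocycle_def)

lemma loop_scale_add: "loop_scale c (u + v) = loop_scale c u + loop_scale c v"
  by (rule poly_mapping_eqI) (simp add: lookup_add scale_right_distrib)

lemma loop_scale_single [simp]: "loop_scale c (single i x) = single i (scale c x)"
  by (rule poly_mapping_eqI) (simp add: lookup_single when_def)

lemma loop_scale_zero [simp]: "loop_scale c 0 = 0" "loop_scale 0 u = 0"
  by (rule poly_mapping_eqI, simp)+

lemma loop_derivation_add: "loop_derivation (u + v) = loop_derivation u + loop_derivation v"
  by (rule poly_mapping_eqI) (simp add: lookup_add scale_right_distrib)

lemma loop_derivation_single [simp]: "loop_derivation (single i x) = single i (scale (of_int i) x)"
  by (rule poly_mapping_eqI) (simp add: lookup_single when_def)

lemma loop_derivation_zero [simp]: "loop_derivation 0 = 0"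
  by (rule poly_mapping_eqI) simp

lemma loop_derivation_scale: "loop_derivation (loop_scale c u) = loop_scale c (loop_derivation u)"
  by (rule poly_mapping_eqI) (simp add: mult.commute)

lemma loop_bracket_scale:
  "loop_bracket (loop_scale c u) v = loop_scale c (loop_bracket u v)" (is ?L)
  "loop_bracket u (loop_scale c v) = loop_scale c (loop_bracket u v)" (is ?R)
proof -
  have L: "loop_bracket (loop_scale c (single i x)) v = loop_scale c (loop_bracket (single i x) v)"
    and R: "loop_bracket (single i x) (loop_scale c v) = loop_scale c (loop_bracket (single i x) v)" for i x
    by (induction v rule: poly_mapping_add_induct)
      (simp_all add: loop_bracket_add_right loop_scale_add del: loop_scale_single, simp_all)
  show ?L
    by (induction u rule: poly_mapping_add_induct)
      (simp_all add: L loop_bracket_add_left loop_scale_add del: loop_scale_single)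
  show ?R
    by (induction u rule: poly_mapping_add_induct)
      (simp_all add: R loop_bracket_add_left loop_scale_add)
qed

lemma loop_cocycle_scale:
  "loop_cocycle (loop_scale c u) v = c * loop_cocycle u v" (is ?L)
  "loop_cocycle u (loop_scale c v) = c * loop_cocycle u v" (is ?R)
proof -
  have L: "loop_cocycle (loop_scale c (single i x)) v = c * loop_cocycle (single i x) v"
    and R: "loop_cocycle (single i x) (loop_scale c v) = c * loop_cocycle (single i x) v" for i x
    by (induction v rule: poly_mapping_add_induct)
      (simp_all add: loop_cocycle_add_right loop_scale_add distrib_left del: loop_scale_single, simp_all)
  show ?L
    by (induction u rule: poly_mapping_add_induct)
      (simp_all add: L loop_cocycle_add_left loop_scale_add distrib_left del: loop_scale_single)
  show ?R
    by (induction u rule: poly_mapping_add_induct)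
      (simp_all add: R loop_cocycle_add_left loop_scale_add distrib_left)
qed

lemma vector_space_affine: "vector_space affine_scale"
  by unfold_locales
    (auto simp: affine_scale_def plus_prod_def lookup_add scale_right_distrib scale_left_distrib
      algebra_simps intro!: poly_mapping_eqI)

section \<open>Antisymmetry, derivation and Jacobi identities on loops\<close>

lemma loop_bracket_commute: "loop_bracket u v = - loop_bracket v u"
proof -
  have "loop_bracket (single i x) v = - loop_bracket v (single i x)" for i x
    by (induction v rule: poly_mapping_add_induct)
      (simp_all add: loop_bracket_add_left loop_bracket_add_right add.commute flip: single_uminus bracket_commute)
  then show ?thesis
    by (induction u rule: poly_mapping_add_induct)
      (simp_all add: loop_bracket_add_left loop_bracket_add_right)
qed

lemma loop_cocycle_commute: "loop_cocycle u v = - loop_cocycle v u"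
proof -
  have "loop_cocycle (single i x) v = - loop_cocycle v (single i x)" for i x
  proof (induction v rule: poly_mapping_add_induct)
    case (single j y)
    then show ?case
      using killing_commute [of x y] by (cases "j = - i") (auto simp: add_eq_0_iff)
  qed (simp_all add: loop_cocycle_add_left loop_cocycle_add_right)
  then show ?thesis
    by (induction u rule: poly_mapping_add_induct)
      (simp_all add: loop_cocycle_add_left loop_cocycle_add_right)
qed

lemma loop_bracket_same: "loop_bracket u u = 0"
proof (rule poly_mapping_eqI)
  fix i
  have "loop_bracket u u + loop_bracket u u = 0"
    using loop_bracket_commute [of u u] by (simp add: eq_neg_iff_add_eq_0)
  then have "lookup (loop_bracket u u) i + lookup (loop_bracket u u) i = 0"
    by (metis lookup_add lookup_zero)
  from add_self_eq_0D [OF this] show "lookup (loop_bracket u u) i = lookup 0 i"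
    by simp
qed

lemma loop_cocycle_same: "loop_cocycle u u = 0"
proof -
  have "2 * loop_cocycle u u = 0"
    by (metis loop_cocycle_commute mult_2 add.right_inverse)
  then show ?thesis
    by simp
qed

lemma loop_derivation_bracket:
  "loop_derivation (loop_bracket u v) = loop_bracket (loop_derivation u) v + loop_bracket u (loop_derivation v)"
proof -
  have "loop_derivation (loop_bracket (single i x) v) =
      loop_bracket (loop_derivation (single i x)) v + loop_bracket (single i x) (loop_derivation v)" for i x
    by (induction v rule: poly_mapping_add_induct)
      (simp_all add: loop_bracket_add_right loop_derivation_add algebra_simps scale_left_distrib flip: single_add)
  then show ?thesis
    by (induction u rule: poly_mapping_add_induct)
      (simp_all add: loop_bracket_add_left loop_derivation_add algebra_simps)
qed

text \<open>On monomials of opposite degrees i and -i both sides are i^2 times the Killing form.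
  With antisymmetry this is the invariance of the cocycle under d, which the central component of
  the affine Jacobi identity needs.\<close>

lemma loop_cocycle_derivation: "loop_cocycle (loop_derivation u) v = loop_cocycle (loop_derivation v) u"
proof -
  have "loop_cocycle (loop_derivation (single i x)) v = loop_cocycle (loop_derivation v) (single i x)" for i x
  proof (induction v rule: poly_mapping_add_induct)
    case (single j y)
    then show ?case
      using killing_commute [of x y] by (cases "j = - i") (auto simp: add_eq_0_iff)
  qed (simp_all add: loop_cocycle_add_left loop_cocycle_add_right loop_derivation_add)
  then show ?thesis
    by (induction u rule: poly_mapping_add_induct)
      (simp_all add: loop_cocycle_add_left loop_cocycle_add_right loop_derivation_add)
qed

lemma loop_jacobi:
  "loop_bracket (loop_bracket u v) w + loop_bracket (loop_bracket v w) u +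
    loop_bracket (loop_bracket w u) v = 0"
proof -
  let ?J = "\<lambda>u v w. loop_bracket (loop_bracket u v) w + loop_bracket (loop_bracket v w) u +
    loop_bracket (loop_bracket w u) v"
  have add1: "?J (u + u') v w = ?J u v w + ?J u' v w"
    and add2: "?J u (v + v') w = ?J u v w + ?J u v' w"
    and add3: "?J u v (w + w') = ?J u v w + ?J u v w'" for u v w u' v' w'
    by (simp_all add: loop_bracket_add_left loop_bracket_add_right)
  have single: "?J (single i x) (single j y) (single k z) = 0" for i j k x y z
    using jacobi [of x y z] by (simp add: ac_simps flip: single_add)
  \<comment> \<open>By trilinearity the arguments are freed one at a time, from monomials to
    arbitrary loops.\<close>
  have "?J (single i x) (single j y) w = 0" for i j x y
    by (induction w rule: poly_mapping_add_induct, simp, rule single, subst add3, simp)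
  then have "?J (single i x) v w = 0" for i x
    by (induction v rule: poly_mapping_add_induct) (simp, blast, subst add2, simp)
  then show ?thesis
    by (induction u rule: poly_mapping_add_induct) (simp, blast, subst add1, simp)
qed

text \<open>For monomials of total degree 0, invariance makes the three Killing values equal; their
  coefficients i + j, j + k and k + i add up to twice the total degree.\<close>

lemma loop_cocycle_jacobi:
  "loop_cocycle (loop_bracket u v) w + loop_cocycle (loop_bracket v w) u +
    loop_cocycle (loop_bracket w u) v = 0"
proof -
  let ?J = "\<lambda>u v w. loop_cocycle (loop_bracket u v) w + loop_cocycle (loop_bracket v w) u +
    loop_cocycle (loop_bracket w u) v"
  have add1: "?J (u + u') v w = ?J u v w + ?J u' v w"
    and add2: "?J u (v + v') w = ?J u v w + ?J u v' w"
    and add3: "?J u v (w + w') = ?J u v w + ?J u v w'" for u v w u' v' w'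
    by (simp_all add: loop_bracket_add_left loop_bracket_add_right loop_cocycle_add_left loop_cocycle_add_right)
  have single: "?J (single i x) (single j y) (single k z) = 0" for i j k x y z
  proof (cases "i + j + k = 0")
    case True
    then have k: "k = - i - j"
      by simp
    have "killing (bracket y z) x = killing (bracket x y) z" "killing (bracket z x) y = killing (bracket x y) z"
      using killing_invariant [of x y z] killing_invariant [of z x y] by simp_all
    then show ?thesis
      unfolding k by (simp add: algebra_simps)
  qed (simp add: ac_simps)
  have "?J (single i x) (single j y) w = 0" for i j x y
    by (induction w rule: poly_mapping_add_induct, simp, rule single, subst add3, simp)
  then have "?J (single i x) v w = 0" for i x
    by (induction v rule: poly_mapping_add_induct) (simp, blast, subst add2, simp)
  then show ?thesis
    by (induction u rule: poly_mapping_add_induct) (simp, blast, subst add1, simp)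
qed

end

section \<open>Hom-Lie structures\<close>

context lie_algebra
begin

abbreviation "map_scale \<equiv> \<lambda>c \<phi> x. scale c (\<phi> x)"

lemma vector_space_maps: "vector_space map_scale"
  by unfold_locales (auto simp: scale_right_distrib scale_left_distrib)

lemma in_hom_lie_structuresD:
  assumes "\<phi> \<in> hom_lie_structures"
  shows "x \<in> L \<Longrightarrow> \<phi> x \<in> L"
    and "x \<in> L \<Longrightarrow> y \<in> L \<Longrightarrow> \<phi> (x + y) = \<phi> x + \<phi> y"
    and "x \<in> L \<Longrightarrow> \<phi> (scale c x) = scale c (\<phi> x)"
    and "x \<notin> L \<Longrightarrow> \<phi> x = 0"
    and "x \<in> L \<Longrightarrow> y \<in> L \<Longrightarrow> z \<in> L \<Longrightarrow>
      bracket (bracket x y) (\<phi> z) + bracket (bracket z x) (\<phi> y) + bracket (bracket y z) (\<phi> x) = 0"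
  using assms by (simp_all add: hom_lie_structures_def endomorphisms_def)

lemma identity_map_hom_lie: "identity_map \<in> hom_lie_structures"
proof -
  have "bracket (bracket x y) z + bracket (bracket z x) y + bracket (bracket y z) x = 0"
    if "x \<in> L" "y \<in> L" "z \<in> L" for x y z
    using jacobi [OF that] by (simp add: ac_simps)
  then show ?thesis
    using subspace_add [OF subspace_carrier] subspace_scale [OF subspace_carrier]
    by (auto simp: hom_lie_structures_def endomorphisms_def identity_map_def)
qed

lemma subspace_hom_lie_structures: "module.subspace map_scale hom_lie_structures"
proof -
  interpret maps: vector_space map_scale
    by (rule vector_space_maps)
  have zero [simp]: "bracket x 0 = 0" if "x \<in> L" for x
    using bracket_scale_right [of x x 0] that by simp
  have zL: "0 \<in> L"
    by (rule subspace_0 [OF subspace_carrier])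
  show ?thesis
  proof (rule maps.subspaceI)
    show "0 \<in> hom_lie_structures"
      using zL by (auto simp: hom_lie_structures_def endomorphisms_def bracket_closed)
  next
    fix \<phi> \<psi> assume *: "\<phi> \<in> hom_lie_structures" "\<psi> \<in> hom_lie_structures"
    note D = in_hom_lie_structuresD [OF *(1)] in_hom_lie_structuresD [OF *(2)]
    have "bracket (bracket x y) (\<phi> z + \<psi> z) + bracket (bracket z x) (\<phi> y + \<psi> y)
        + bracket (bracket y z) (\<phi> x + \<psi> x) = 0" (is "?s = 0") if "x \<in> L" "y \<in> L" "z \<in> L" for x y z
    proof -
      have "?s = (bracket (bracket x y) (\<phi> z) + bracket (bracket z x) (\<phi> y) + bracket (bracket y z) (\<phi> x))
          + (bracket (bracket x y) (\<psi> z) + bracket (bracket z x) (\<psi> y) + bracket (bracket y z) (\<psi> x))"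
        using that by (simp add: bracket_add_right bracket_closed D(1,6) ac_simps)
      then show ?thesis
        using D(5,10) that by simp
    qed
    then show "\<phi> + \<psi> \<in> hom_lie_structures"
      using D(1-4,6-9) subspace_add [OF subspace_carrier]
      by (auto simp: hom_lie_structures_def endomorphisms_def scale_right_distrib ac_simps)
  next
    fix c \<phi> assume *: "\<phi> \<in> hom_lie_structures"
    note D = in_hom_lie_structuresD [OF *]
    have "bracket (bracket x y) (scale c (\<phi> z)) + bracket (bracket z x) (scale c (\<phi> y))
        + bracket (bracket y z) (scale c (\<phi> x)) = 0" if "x \<in> L" "y \<in> L" "z \<in> L" for x y z
      using that D(5) [OF that] by (simp add: bracket_scale_right bracket_closed D(1) flip: scale_right_distrib)
    then show "(\<lambda>x. scale c (\<phi> x)) \<in> hom_lie_structures"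
      using D(1-4) subspace_scale [OF subspace_carrier]
      by (auto simp: hom_lie_structures_def endomorphisms_def scale_right_distrib mult.commute)
  qed
qed

text \<open>Hom-Lie structures form a subspace, so subtracting a multiple of the identity leaves a
  Hom-Lie structure, which is central as soon as its values are.\<close>

lemma hom_lie_structures_eq_map_span:
  assumes "\<And>\<phi>. \<phi> \<in> hom_lie_structures \<Longrightarrow>
    \<exists>c. \<forall>x\<in>L. \<phi> x - scale c x \<in> center"
  shows "hom_lie_structures = map_span (central_hom_lie_structures \<union> {identity_map})"
proof -
  interpret maps: vector_space map_scale
    by (rule vector_space_maps)
  let ?S = "central_hom_lie_structures \<union> {identity_map}"
  have "\<phi> \<in> maps.span ?S" if \<phi>: "\<phi> \<in> hom_lie_structures" for \<phi>
  proof -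
    obtain c where c: "\<And>x. x \<in> L \<Longrightarrow> \<phi> x - scale c x \<in> center"
      using assms [OF \<phi>] by blast
    \<comment> \<open>\<open>identity_map\<close> is extended by 0 off \<open>L\<close> just as
      \<phi> is, so the difference is again a represented endomorphism.\<close>
    define \<psi> where "\<psi> = \<phi> - map_scale c identity_map"
    have "\<psi> \<in> hom_lie_structures"
      unfolding \<psi>_def
      by (intro maps.subspace_diff [OF subspace_hom_lie_structures]
          maps.subspace_scale [OF subspace_hom_lie_structures] \<phi> identity_map_hom_lie)
    with c have "\<psi> \<in> central_hom_lie_structures"
      by (simp add: central_hom_lie_structures_def \<psi>_def identity_map_def)
    then have "\<psi> + map_scale c identity_map \<in> maps.span ?S"
      by (intro maps.span_add maps.span_scale maps.span_base) auto
    moreover have "\<psi> + map_scale c identity_map = \<phi>"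
      unfolding \<psi>_def by (rule diff_add_cancel)
    ultimately show ?thesis
      by metis
  qed
  moreover have "maps.span ?S \<subseteq> hom_lie_structures"
    by (intro maps.span_minimal subspace_hom_lie_structures)
      (auto simp: central_hom_lie_structures_def identity_map_hom_lie)
  ultimately show ?thesis
    unfolding map_span_def by auto
qed

end

section \<open>The affine algebra of a graded Lie algebra\<close>

context finite_dimensional_lie_algebra
begin

lemma fst_affine_bracket:
  "fst (affine_bracket x y) = loop_bracket (fst x) (fst y) + loop_scale (fst (snd x)) (loop_derivation (fst y))
    - loop_scale (fst (snd y)) (loop_derivation (fst x))"
  by (simp add: affine_bracket_def case_prod_beta)

lemma fst_snd_affine_bracket: "fst (snd (affine_bracket x y)) = 0"
  by (simp add: affine_bracket_def case_prod_beta)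

lemma lookup_loop_bracket_single: "lookup (loop_bracket (single i x) v) k = bracket x (lookup v (k - i))"
  by (induction v rule: poly_mapping_add_induct)
    (auto simp: loop_bracket_add_right lookup_add lookup_single when_def)

lemma loop_bracket_minus:
  "loop_bracket (u - u') v = loop_bracket u v - loop_bracket u' v"
  using loop_bracket_add_left [of "u - u'" u' v] by simp

lemma loop_cocycle_minus:
  "loop_cocycle (u - u') v = loop_cocycle u v - loop_cocycle u' v"
  using loop_cocycle_add_left [of "u - u'" u' v] by simp

lemma loop_derivation_minus: "loop_derivation (u - v) = loop_derivation u - loop_derivation v"
  using loop_derivation_add [of "u - v" v] by simp

lemma loop_scale_minus: "loop_scale c (u - v) = loop_scale c u - loop_scale c v"
  using loop_scale_add [of c "u - v" v] by simp

lemma affine_jacobi: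
  "affine_bracket (affine_bracket x y) z + affine_bracket (affine_bracket y z) x +
    affine_bracket (affine_bracket z x) y = 0"
proof -
  obtain u a c v b d w e f where xyz: "x = (u, a, c)" "y = (v, b, d)" "z = (w, e, f)"
    by (metis surj_pair)
  note simps = loop_bracket_add_left loop_bracket_minus loop_bracket_scale loop_scale_add loop_scale_minus
    loop_derivation_add loop_derivation_minus loop_derivation_scale loop_derivation_bracket
    loop_cocycle_add_left loop_cocycle_minus loop_cocycle_scale
  define S where "S x = loop_scale x" for x
  define LB where "LB = loop_bracket"
  have SS: "S x (S y u) = S y (S x u)" for x y u
    by (rule poly_mapping_eqI) (simp add: S_def mult.commute)
  have S_neg: "S x (- u) = - S x u" for x u
    by (rule poly_mapping_eqI) (simp add: S_def)
  \<comment> \<open>Each bracket of a loop with a derivative is put in alphabetical order, so that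
    equal terms cancel.\<close>
  have comm: "LB (loop_derivation v) u = - LB u (loop_derivation v)"
    "LB (loop_derivation w) u = - LB u (loop_derivation w)"
    "LB (loop_derivation w) v = - LB v (loop_derivation w)"
    "LB w (loop_derivation u) = - LB (loop_derivation u) w"
    "LB v (loop_derivation u) = - LB (loop_derivation u) v"
    "LB w (loop_derivation v) = - LB (loop_derivation v) w"
    unfolding LB_def by (rule loop_bracket_commute)+
  have "loop_bracket (loop_bracket u v) w + loop_bracket (loop_bracket v w) u +
    loop_bracket (loop_bracket w u) v = 0"
    by (rule loop_jacobi)
  then have J: "LB (LB u v) w = - LB (LB v w) u - LB (LB w u) v"
    unfolding LB_def by (simp add: eq_neg_iff_add_eq_0 algebra_simps)
  have 1: "LB (LB u v + S a (loop_derivation v) - S b (loop_derivation u)) w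
      - S e (loop_derivation (LB u v + S a (loop_derivation v) - S b (loop_derivation u)))
    + (LB (LB v w + S b (loop_derivation w) - S e (loop_derivation v)) u
      - S a (loop_derivation (LB v w + S b (loop_derivation w) - S e (loop_derivation v))))
    + (LB (LB w u + S e (loop_derivation u) - S a (loop_derivation w)) v
      - S b (loop_derivation (LB w u + S e (loop_derivation u) - S a (loop_derivation w)))) = 0"
    using SS [of a b] SS [of a e] SS [of b e]
    by (simp add: simps [folded LB_def S_def] J comm S_neg algebra_simps)
  have 2: "loop_cocycle (LB u v + S a (loop_derivation v) - S b (loop_derivation u)) w
    + loop_cocycle (LB v w + S b (loop_derivation w) - S e (loop_derivation v)) u
    + loop_cocycle (LB w u + S e (loop_derivation u) - S a (loop_derivation w)) v = 0"
    using loop_cocycle_jacobi [of u v w, folded LB_def] loop_cocycle_derivation [of u v]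
      loop_cocycle_derivation [of u w] loop_cocycle_derivation [of v w]
    by (simp add: simps [folded LB_def S_def] algebra_simps)
  show ?thesis
    using 1 2 unfolding xyz
    by (simp add: affine_bracket_def zero_prod_def S_def LB_def algebra_simps)
qed

end

text \<open>Common ground of the untwisted and the twisted case, with \<open>G 0\<close> in the role
  of D. A nonzero vector of \<open>G 0\<close>, placed in degrees divisible by \<open>n\<close>,
  serves to detect d-components.\<close>

locale graded_lie_algebra = finite_dimensional_lie_algebra scale Basis bracket
  for scale :: "complex \<Rightarrow> 'a::ab_group_add \<Rightarrow> 'a" and Basis bracket +
  fixes n :: nat and G :: "int \<Rightarrow> 'a set"
  assumes n_pos: "n > 0"
    and subspace_G: "subspace (G k)"
    and bracket_G: "\<lbrakk>x \<in> G (i mod int n); y \<in> G (j mod int n)\<rbrakk> \<Longrightarrow> bracket x y \<in> G ((i + j) mod int n)"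
    and centralizer_trivial:
      "(\<And>x y. x \<in> G 0 \<Longrightarrow> y \<in> G 0 \<Longrightarrow> bracket (bracket x y) u = 0) \<Longrightarrow> u = 0"
    and G0_nonzero: "\<exists>x\<in>G 0. x \<noteq> 0"
begin

lemma in_affine_carrier_iff: "x \<in> affine_carrier n G \<longleftrightarrow> (\<forall>i. lookup (fst x) i \<in> G (i mod int n))"
  by (simp add: affine_carrier_def case_prod_beta)

lemma single_in_affine_carrier: "x \<in> G (i mod int n) \<Longrightarrow> (single i x, a, c) \<in> affine_carrier n G"
  using subspace_0 [OF subspace_G] by (auto simp: in_affine_carrier_iff lookup_single when_def)

lemma lookup_loop_bracket_in:
  assumes "\<And>i. lookup u i \<in> G (i mod int n)" "\<And>i. lookup v i \<in> G (i mod int n)"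
  shows "lookup (loop_bracket u v) k \<in> G (k mod int n)"
  unfolding loop_bracket_def lookup_sum lookup_single when_def
  using assms subspace_0 [OF subspace_G]
  by (intro subspace_sum [OF subspace_G]) (auto intro: bracket_G)

sublocale affine: lie_algebra affine_scale "affine_carrier n G" affine_bracket
proof -
  interpret aff: vector_space affine_scale
    by (rule vector_space_affine)
  note G = subspace_0 [OF subspace_G] subspace_add [OF subspace_G] subspace_diff [OF subspace_G]
    subspace_scale [OF subspace_G]
  show "lie_algebra affine_scale (affine_carrier n G) affine_bracket"
  proof unfold_locales
    show "aff.subspace (affine_carrier n G)"
      by (rule aff.subspaceI)
        (auto simp: in_affine_carrier_iff affine_scale_def case_prod_beta lookup_add intro: G)
    show "affine_bracket x y \<in> affine_carrier n G"
      if "x \<in> affine_carrier n G" "y \<in> affine_carrier n G" for x y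
      using that
      by (auto simp: in_affine_carrier_iff fst_affine_bracket lookup_add lookup_minus
          intro!: G lookup_loop_bracket_in)
    show "affine_bracket (affine_bracket x y) z + affine_bracket (affine_bracket y z) x +
      affine_bracket (affine_bracket z x) y = 0" for x y z
      by (rule affine_jacobi)
  qed (auto simp: affine_bracket_def affine_scale_def case_prod_beta loop_scale_add
      loop_bracket_add_left loop_bracket_add_right loop_cocycle_add_left loop_cocycle_add_right
      loop_bracket_scale loop_cocycle_scale loop_derivation_add loop_derivation_scale loop_bracket_same
      loop_cocycle_same zero_prod_def lookup_add lookup_minus algebra_simps scale_right_distrib
      scale_left_distrib scale_right_diff_distrib intro!: prod_eqI poly_mapping_eqI)
qed

end

section \<open>Hom-Lie structures on the affine algebra\<close>

context graded_lie_algebra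
begin

lemma affine_center: "fst x = 0 \<Longrightarrow> fst (snd x) = 0 \<Longrightarrow> x \<in> affine.center"
  unfolding affine.center_def using subspace_0 [OF subspace_G]
  by (auto simp: in_affine_carrier_iff affine_bracket_def case_prod_beta zero_prod_def)

lemma zero_loop_in_affine_carrier: "(0, a, c) \<in> affine_carrier n G"
  using subspace_0 [OF subspace_G] by (simp add: in_affine_carrier_iff)

text \<open>The assumption on \<phi> d is the normalization reached by subtracting a multiple of the
  identity. Loop and d-components of \<phi> are shown to vanish on monomials, on z and on d, and
  then everywhere by additivity.\<close>

lemma hom_lie_structure_central:
  assumes \<phi>: "\<phi> \<in> affine.hom_lie_structures" and d: "fst (snd (\<phi> (0, 1, 0))) = 0"
    and x: "x \<in> affine_carrier n G"
  shows "\<phi> x \<in> affine.center"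
proof -
  note \<phi>D = affine.in_hom_lie_structuresD [OF \<phi>]
  define w where "w = lookup (fst (\<phi> (0, 1, 0)))"
  define U where "U i x = lookup (fst (\<phi> (single i x, 0, 0)))" for i x
  define b where "b i x = fst (snd (\<phi> (single i x, 0, 0)))" for i x
  have kill: "u = 0" if "\<And>x y. x \<in> G 0 \<Longrightarrow> y \<in> G 0 \<Longrightarrow> bracket (bracket x y) u = 0" for u
    using centralizer_trivial that by blast
  have bracket_G0: "bracket x y \<in> G 0" if "x \<in> G 0" "y \<in> G 0" for x y
    using bracket_G [of x 0 y 0] that by simp
  \<comment> \<open>Coefficient of t^k in the identity for x t^i, y t^j and d. Bracketing with d
    gives one factor i, and the d-component \<open>b j y\<close> of \<phi> (y t^j) a second one. A
    d-component of \<phi> d would add a multiple of (i + j) [x, y].\<close>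
  have E1: "bracket (bracket x y) (w (k - i - j)) +
      (scale (of_int i) (bracket x (U j y (k - i))) - scale (of_int i * of_int i * b j y) (if k = i then x else 0)) -
      (scale (of_int j) (bracket y (U i x (k - j))) - scale (of_int j * of_int j * b i x) (if k = j then y else 0)) = 0"
    if "x \<in> G (i mod int n)" "y \<in> G (j mod int n)" for i j k x y
  proof -
    let ?x = "(single i x, 0, 0)" and ?y = "(single j y, 0, 0)" and ?d = "(0, 1, 0)"
    have "affine_bracket (affine_bracket ?x ?y) (\<phi> ?d)
        + affine_bracket (affine_bracket ?d ?x) (\<phi> ?y)
        + affine_bracket (affine_bracket ?y ?d) (\<phi> ?x) = 0"
      using that by (intro \<phi>D single_in_affine_carrier zero_loop_in_affine_carrier)
    then have "lookup (fst (affine_bracket (affine_bracket ?x ?y) (\<phi> ?d)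
        + affine_bracket (affine_bracket ?d ?x) (\<phi> ?y)
        + affine_bracket (affine_bracket ?y ?d) (\<phi> ?x))) k = 0"
      by simp
    then show ?thesis
      using d
      by (simp add: fst_affine_bracket fst_snd_affine_bracket lookup_add lookup_minus lookup_loop_bracket_single
          U_def b_def w_def lookup_single when_def algebra_simps flip: single_uminus split: if_splits)
  qed
  \<comment> \<open>The corresponding coefficient when x of degree 0 takes the place of d.\<close>
  have E2: "bracket (bracket x y) (U j z (k - i)) - scale (of_int i * b j z) (if k = i then bracket x y else 0) +
      (bracket (bracket z x) (U i y (k - j)) - scale (of_int j * b i y) (if k = j then bracket z x else 0)) +
      (bracket (bracket y z) (U 0 x (k - i - j)) - scale (of_int (i + j) * b 0 x)
        (if k = i + j then bracket y z else 0)) = 0"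
    if "x \<in> G 0" "y \<in> G (i mod int n)" "z \<in> G (j mod int n)" for i j k x y z
  proof -
    let ?x = "(single 0 x, 0, 0)" and ?y = "(single i y, 0, 0)" and ?z = "(single j z, 0, 0)"
    have "affine_bracket (affine_bracket ?x ?y) (\<phi> ?z)
        + affine_bracket (affine_bracket ?z ?x) (\<phi> ?y)
        + affine_bracket (affine_bracket ?y ?z) (\<phi> ?x) = 0"
      using that by (intro \<phi>D single_in_affine_carrier) auto
    then have "lookup (fst (affine_bracket (affine_bracket ?x ?y) (\<phi> ?z)
        + affine_bracket (affine_bracket ?z ?x) (\<phi> ?y)
        + affine_bracket (affine_bracket ?y ?z) (\<phi> ?x))) k = 0"
      by simp
    then show ?thesis
      by (simp add: fst_affine_bracket fst_snd_affine_bracket lookup_add lookup_minus lookup_loop_bracket_single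
          U_def b_def lookup_single when_def algebra_simps split: if_splits)
  qed
  obtain e where e: "e \<in> G 0" "e \<noteq> 0"
    using G0_nonzero by blast
  \<comment> \<open>An element x of \<open>G 0\<close> may be placed in any degree s n. Reading
    \<open>E1\<close> at t^(k + s n) with j = 0 keeps the three vectors independent of s, leaving a
    quadratic polynomial in s.\<close>
  have quad: "bracket (bracket x y) (w k) = 0 \<and> bracket x (U 0 y k) = 0 \<and>
      scale (- b 0 y) (if k = 0 then x else 0) = 0" if "x \<in> G 0" "y \<in> G 0" for x y k
  proof (rule quadratic_coefficients_eq_0 [where t = "of_nat n" and t' = "of_nat n * of_nat n"])
    show "bracket (bracket x y) (w k) + scale (s * of_nat n) (bracket x (U 0 y k)) +
        scale (s * s * (of_nat n * of_nat n)) (scale (- b 0 y) (if k = 0 then x else 0)) = 0"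
      if s: "s \<in> {1, 2, 3}" for s
    proof -
      define s' :: int where "s' = (if s = 1 then 1 else if s = 2 then 2 else 3)"
      have s': "s = of_int s'"
        using s by (auto simp: s'_def)
      show ?thesis
        using E1 [of x "s' * int n" y 0 "k + s' * int n"] \<open>x \<in> G 0\<close> \<open>y \<in> G 0\<close>
        by (simp add: s' algebra_simps split: if_splits)
    qed
  qed (use n_pos in auto)
  have w0: "w k = 0" for k
    using kill quad by blast
  have U0: "U 0 y k = 0" if "y \<in> G 0" for y k
    using kill quad [OF bracket_G0 that] by blast
  \<comment> \<open>The quadratic coefficient at k = 0 is a multiple of the nonzero vector
    \<open>e\<close>.\<close>
  have b0: "b 0 y = 0" if "y \<in> G 0" for y
    using quad [OF e(1) that, of 0] e(2) by simp
  have U: "U j z k = 0" if "z \<in> G (j mod int n)" for j z k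
  proof (rule kill)
    fix x y assume "x \<in> G 0" "y \<in> G 0"
    then show "bracket (bracket x y) (U j z k) = 0"
      \<comment> \<open>With i = 0 the other two terms involve only \<phi> on degree 0 elements of
        \<open>G 0\<close>, where \<open>U\<close> and \<open>b\<close> already vanish.\<close>
      using E2 [of x y 0 z j k] that U0 b0 by simp
  qed
  have b: "b j z = 0" if "z \<in> G (j mod int n)" for j z
  proof -
    \<comment> \<open>In \<open>E1\<close> at t^i with x = \<open>e\<close>, the choice of i
      different from j isolates i^2 times \<open>b j z\<close> times \<open>e\<close>, and i
      different from 0 keeps that factor nonzero. One of n and -n qualifies.\<close>
    obtain i where i: "i mod int n = 0" "i \<noteq> 0" "i \<noteq> j"
    proof (cases "j = int n")
      case True
      then show ?thesis
        using that [of "- int n"] n_pos by auto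
    next
      case False
      then show ?thesis
        using that [of "int n"] n_pos by auto
    qed
    then show ?thesis
      using E1 [of e i z j i] e that U w0 by simp
  qed
  have cz: "\<phi> (0, 0, c) \<in> affine.center" for c
  proof -
    \<comment> \<open>Brackets with a multiple of z vanish, so one term of the identity
      survives.\<close>
    have E: "affine_bracket (affine_bracket (single i x, 0, 0) (single 0 y, 0, 0)) (\<phi> (0, 0, c)) = 0"
      if "x \<in> G (i mod int n)" "y \<in> G 0" for i x y
    proof -
      have "affine_bracket (0, 0, c) v = 0" "affine_bracket v (0, 0, c) = 0" for v
        by (simp_all add: affine_bracket_def case_prod_beta zero_prod_def)
      moreover have "affine_bracket 0 v = 0" for v
        by (simp add: affine_bracket_def case_prod_beta zero_prod_def)
      ultimately show ?thesis
        using \<phi>D(5) [of "(single i x, 0, 0)" "(single 0 y, 0, 0)" "(0, 0, c)"] that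
        by (simp add: single_in_affine_carrier zero_loop_in_affine_carrier)
    qed
    have E': "bracket (bracket x y) (lookup (fst (\<phi> (0, 0, c))) (k - i)) =
        scale (of_int i * fst (snd (\<phi> (0, 0, c)))) (if k = i then bracket x y else 0)"
      if "x \<in> G (i mod int n)" "y \<in> G 0" for i k x y
      using arg_cong [OF E [OF that], of "\<lambda>x. lookup (fst x) k"]
      by (simp add: fst_affine_bracket fst_snd_affine_bracket lookup_add lookup_minus lookup_loop_bracket_single
          lookup_single when_def algebra_simps split: if_splits)
    have *: "lookup (fst (\<phi> (0, 0, c))) k = 0" for k
    proof (rule kill)
      fix x y assume "x \<in> G 0" "y \<in> G 0"
      then show "bracket (bracket x y) (lookup (fst (\<phi> (0, 0, c))) k) = 0"
        using E' [of x 0 y k] by simp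
    qed
    \<comment> \<open>If all these brackets vanished, the centralizer condition would force
      \<open>e\<close> to be 0.\<close>
    obtain x y where xy: "x \<in> G 0" "y \<in> G 0" "bracket x y \<noteq> 0"
      using kill [OF _, of e] e(2) by (metis bracket_zero(1))
    have "fst (snd (\<phi> (0, 0, c))) = 0"
      \<comment> \<open>The degree n rather than 0 makes the d-component act by a nonzero
        factor.\<close>
      using E' [of x "int n" y "int n"] xy * n_pos by simp
    with * show ?thesis
      by (intro affine_center poly_mapping_eqI) auto
  qed
  have cd: "\<phi> (0, a, 0) \<in> affine.center" for a
  proof -
    have "\<phi> (affine_scale a (0, 1, 0)) = affine_scale a (\<phi> (0, 1, 0))"
      by (intro \<phi>D zero_loop_in_affine_carrier)
    then have "\<phi> (0, a, 0) = affine_scale a (\<phi> (0, 1, 0))"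
      by (simp add: affine_scale_def)
    moreover have "fst (affine_scale a (\<phi> (0, 1, 0))) = 0" "fst (snd (affine_scale a (\<phi> (0, 1, 0)))) = 0"
      using w0 d unfolding w_def by (auto simp: affine_scale_def case_prod_beta intro!: poly_mapping_eqI)
    ultimately show ?thesis
      by (intro affine_center) auto
  qed
  have cs: "\<phi> (single i x, 0, 0) \<in> affine.center" if "x \<in> G (i mod int n)" for i x
    using U [OF that] b [OF that] unfolding U_def b_def
    by (intro affine_center poly_mapping_eqI) auto
  have center_add: "\<phi> (u + v) \<in> affine.center"
    if "u \<in> affine_carrier n G" "v \<in> affine_carrier n G" "\<phi> u \<in> affine.center" "\<phi> v \<in> affine.center" for u v
    using that unfolding affine.center_def
    by (auto simp: \<phi>D affine.bracket_add_left intro: affine.subspace_add [OF affine.subspace_carrier])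
  obtain u a c where x_eq: "x = (u, a, c)"
    by (metis surj_pair)
  have uG: "lookup u i \<in> G (i mod int n)" for i
    using x by (simp add: x_eq in_affine_carrier_iff)
  have "(\<Sum>i\<in>I. single i (lookup u i), 0, 0) \<in> affine_carrier n G \<and>
      \<phi> (\<Sum>i\<in>I. single i (lookup u i), 0, 0) \<in> affine.center" if "finite I" for I
    using that
  proof induction
    case empty
    then show ?case
      using cz [of 0] zero_loop_in_affine_carrier [of 0 0] by (simp add: zero_prod_def)
  next
    case (insert i I)
    have *: "(\<Sum>i\<in>insert i I. single i (lookup u i), 0, 0) =
        (single i (lookup u i), 0, 0) + (\<Sum>i\<in>I. single i (lookup u i), 0::complex, 0::complex)"
      using insert by simp
    show ?case
      unfolding * by (intro conjI center_add cs single_in_affine_carrier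
          affine.subspace_add [OF affine.subspace_carrier] uG)
        (use insert in blast)+
  qed
  from this [of "Poly_Mapping.keys u"] have "(u, 0, 0) \<in> affine_carrier n G" "\<phi> (u, 0, 0) \<in> affine.center"
    by (simp_all add: poly_mapping_eq_sum_single)
  then have "\<phi> ((u, 0, 0) + ((0, a, 0) + (0, 0, c))) \<in> affine.center"
    by (intro center_add cz cd zero_loop_in_affine_carrier affine.subspace_add [OF affine.subspace_carrier])
  then show ?thesis
    by (simp add: x_eq)
qed

theorem hom_lie_structures_affine:
  "affine.hom_lie_structures =
    affine.map_span (affine.central_hom_lie_structures \<union> {affine.identity_map})"
proof (rule affine.hom_lie_structures_eq_map_span)
  fix \<phi> assume \<phi>: "\<phi> \<in> affine.hom_lie_structures"
  interpret maps: vector_space affine.map_scale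
    by (rule affine.vector_space_maps)
  define a where "a = fst (snd (\<phi> (0, 1, 0)))"
  define \<psi> where "\<psi> = \<phi> - affine.map_scale a affine.identity_map"
  have \<psi>: "\<psi> \<in> affine.hom_lie_structures"
    unfolding \<psi>_def
    by (intro maps.subspace_diff [OF affine.subspace_hom_lie_structures]
        maps.subspace_scale [OF affine.subspace_hom_lie_structures] \<phi> affine.identity_map_hom_lie)
  have "fst (snd (\<psi> (0, 1, 0))) = 0"
    using zero_loop_in_affine_carrier [of 1 0]
    by (simp add: \<psi>_def a_def affine.identity_map_def affine_scale_def)
  then have "\<psi> x \<in> affine.center" if "x \<in> affine_carrier n G" for x
    using hom_lie_structure_central [OF \<psi>] that by blast
  then show "\<exists>c. \<forall>x\<in>affine_carrier n G. \<phi> x - affine_scale c x \<in> affine.center"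
    by (intro exI [of _ a]) (auto simp: \<psi>_def affine.identity_map_def)
qed

end

section \<open>Fixed points of diagram automorphisms\<close>

context finite_dimensional_lie_algebra
begin

lemma subspace_centralizer: "subspace {y. bracket x y = 0}"
  by (rule subspaceI) auto

lemma subspace_bracket_vimage: "subspace V \<Longrightarrow> subspace {y. bracket x y \<in> V}"
  by (rule subspaceI) (auto simp: subspace_0 subspace_add subspace_scale)

text \<open>A basis of the span can be chosen inside \<open>S\<close>; there \<open>g\<close> is
  diagonal with nonzero entries, hence injective, even if eigenvalues coincide.\<close>

lemma linear_endo_eq_0_on_eigenvectors:
  assumes "Vector_Spaces.linear scale scale g"
    and "\<And>s. s \<in> S \<Longrightarrow> \<exists>k. k \<noteq> 0 \<and> g s = scale k s"
    and "q \<in> span S" "g q = 0"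
  shows "q = 0"
proof -
  interpret g: Vector_Spaces.linear scale scale g by fact
  obtain B where B: "B \<subseteq> S" "independent B" "S \<subseteq> span B"
    by (rule maximal_independent_subset)
  obtain k where k: "\<And>b. b \<in> S \<Longrightarrow> k b \<noteq> 0 \<and> g b = scale (k b) b"
    using assms(2) by metis
  have fin: "finite B"
    by (rule finiteI_independent [OF B(2)])
  have "q \<in> span B"
    using assms(3) span_mono [OF B(3)] by (simp add: span_span subset_iff)
  then obtain c where c: "q = (\<Sum>b\<in>B. scale (c b) b)"
    unfolding span_finite [OF fin] by blast
  have "g q = (\<Sum>b\<in>B. scale (c b * k b) b)"
    unfolding c g.sum using k B(1) by (intro sum.cong) (auto simp: g.scale)
  then have "c b * k b = 0" if "b \<in> B" for b
    using independentD [OF B(2) fin order_refl, of "\<lambda>b. c b * k b" b] assms(4) that by simp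
  then have "c b = 0" if "b \<in> B" for b
    using k [of b] B(1) that by auto
  then show ?thesis
    unfolding c by simp
qed

text \<open>Right-normed iterated brackets of the generators. For the families \<open>e\<close> and
  \<open>f\<close> they span the two nilpotent halves of the triangular decomposition.\<close>

inductive_set ad_orbit :: "nat \<Rightarrow> (nat \<Rightarrow> 'a) \<Rightarrow> 'a set" for r e where
  base: "i < r \<Longrightarrow> e i \<in> ad_orbit r e"
| step: "i < r \<Longrightarrow> x \<in> ad_orbit r e \<Longrightarrow> bracket (e i) x \<in> ad_orbit r e"

text \<open>ad y is a derivation, so eigenvalues add along an iterated bracket.\<close>

lemma ad_orbit_eigenvector:
  assumes "x \<in> ad_orbit r e" "\<And>j. j < r \<Longrightarrow> bracket y (e j) = scale (k j) (e j)"
  shows "\<exists>m. bracket y x = scale m x"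
  using assms(1)
proof induction
  case (base i)
  then show ?case
    using assms(2) by blast
next
  case (step i x)
  then obtain m where m: "bracket y x = scale m x"
    by blast
  have "bracket y (bracket (e i) x) = bracket (bracket y (e i)) x + bracket (e i) (bracket y x)"
    by (simp add: bracket_bracket_left)
  also have "\<dots> = scale (k i + m) (bracket (e i) x)"
    using assms(2) [OF step.hyps(1)] m by (simp add: scale_left_distrib)
  finally show ?case
    by blast
qed

text \<open>With one common eigenvalue on the generators, \<open>m\<close> is the length of the
  iterated bracket. Its positivity keeps ad y invertible on these vectors when \<open>c\<close> is
  nonzero.\<close>

lemma ad_orbit_eigenvalue:
  assumes "x \<in> ad_orbit r e" "\<And>j. j < r \<Longrightarrow> bracket y (e j) = scale c (e j)"
  shows "\<exists>m::nat. m > 0 \<and> bracket y x = scale (of_nat m * c) x"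
  using assms(1)
proof induction
  case (base i)
  then show ?case
    using assms(2) by (intro exI [of _ 1]) auto
next
  case (step i x)
  then obtain m :: nat where m: "bracket y x = scale (of_nat m * c) x"
    by blast
  have "bracket y (bracket (e i) x) = bracket (bracket y (e i)) x + bracket (e i) (bracket y x)"
    by (simp add: bracket_bracket_left)
  also have "\<dots> = scale (of_nat (Suc m) * c) (bracket (e i) x)"
    using assms(2) [OF step.hyps(1)] m by (simp add: scale_left_distrib algebra_simps)
  finally show ?case
    by blast
qed

lemma bracket_in_span:
  assumes "x \<in> span S" "\<And>s. s \<in> S \<Longrightarrow> bracket y s \<in> span T"
  shows "bracket y x \<in> span T"
  using span_induct [OF assms(1) subspace_bracket_vimage [OF subspace_span]] assms(2) by blast

text \<open>In [f i, [e j, x]], the term with [f i, e j] is 0 or a multiple of x, and ad (e j)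
  carries the inductive result back into the span of the orbit. The names are generic so that both
  signs can be treated.\<close>

lemma ad_opposite_ad_orbit:
  assumes "x \<in> ad_orbit r e"
    and fe: "\<And>i j. i < r \<Longrightarrow> j < r \<Longrightarrow> bracket (f i) (e j) = (if i = j then h i else 0)"
    and he: "\<And>i j. i < r \<Longrightarrow> j < r \<Longrightarrow> bracket (h i) (e j) = scale (a i j) (e j)"
    and i: "i < r"
  shows "bracket (f i) x \<in> span (ad_orbit r e \<union> h ` {..<r})"
  using assms(1)
proof induction
  case (base j)
  then show ?case
    using i by (auto simp: fe span_zero intro: span_base)
next
  case (step j x)
  have "bracket (f i) (bracket (e j) x) = bracket (bracket (f i) (e j)) x + bracket (e j) (bracket (f i) x)"
    by (simp add: bracket_bracket_left)
  moreover have "bracket (bracket (f i) (e j)) x \<in> span (ad_orbit r e)"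
  proof (cases "i = j")
    case True
    obtain m where "bracket (h i) x = scale m x"
      using ad_orbit_eigenvector [OF step.hyps(2)] he [OF i] by blast
    then show ?thesis
      using True i step.hyps by (simp add: fe span_scale span_base)
  qed (use i step.hyps in \<open>simp add: fe span_zero\<close>)
  moreover have "bracket (e j) (bracket (f i) x) \<in> span (ad_orbit r e)"
  proof (rule bracket_in_span [OF step.IH])
    fix s assume "s \<in> ad_orbit r e \<union> h ` {..<r}"
    then show "bracket (e j) s \<in> span (ad_orbit r e)"
    proof
      assume "s \<in> h ` {..<r}"
      then obtain l where "l < r" "s = h l"
        by blast
      then show ?thesis
        using step.hyps(1) bracket_commute [of "e j" "h l"]
        by (simp add: he span_neg span_scale span_base ad_orbit.base)
    qed (auto intro: span_base ad_orbit.step step.hyps)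
  qed
  ultimately show ?case
    using span_mono [of "ad_orbit r e" "ad_orbit r e \<union> h ` {..<r}"] by (auto intro: span_add)
qed

text \<open>The center is an ideal, and a proper one because the bracket is not identically
  zero.\<close>

lemma simple_center_trivial:
  assumes "simple" "\<And>y. bracket x y = 0"
  shows "x = 0"
proof -
  let ?Z = "{x. \<forall>y. bracket x y = 0}"
  have "bracket x y \<in> ?Z" if "y \<in> ?Z" for x y
    using that by (simp add: bracket_commute [of x y])
  then have "ideal ?Z"
    by (auto simp: ideal_def intro!: subspaceI)
  moreover have "?Z \<noteq> UNIV"
    using assms(1) by (auto simp: simple_def)
  ultimately show ?thesis
    using assms unfolding simple_def by blast
qed

text \<open>The span of all brackets is a nonzero ideal, hence everything, so \<open>u\<close> is
  central. This is the centralizer condition in the untwisted case.\<close>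

lemma simple_centralizer_derived:
  assumes "simple" "\<And>x y. bracket (bracket x y) u = 0"
  shows "u = 0"
proof (rule simple_center_trivial [OF assms(1)])
  let ?D = "span {bracket x y | x y. True}"
  have "ideal ?D"
    by (auto simp: ideal_def subspace_span intro: span_base)
  moreover obtain x y where xy: "bracket x y \<noteq> 0"
    using assms(1) by (auto simp: simple_def)
  have "bracket x y \<in> ?D"
    by (intro span_base) blast
  with xy have "?D \<noteq> {0}"
    by blast
  ultimately have D: "?D = UNIV"
    using assms(1) unfolding simple_def by blast
  fix y
  have "bracket u d = 0" if "d \<in> {bracket x y | x y. True}" for d
    using that assms(2) bracket_commute [of u] by auto
  then show "bracket u y = 0"
    using span_induct [of y "{bracket x y | x y. True}" "\<lambda>d. bracket u d = 0"] D subspace_centralizer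
    by blast
qed

end

section \<open>Grading element and triangular decomposition from Chevalley generators\<close>

locale simple_chevalley = finite_dimensional_lie_algebra scale Basis bracket
  for scale :: "complex \<Rightarrow> 'a::ab_group_add \<Rightarrow> 'a" and Basis bracket +
  fixes r :: nat and A :: "nat \<Rightarrow> nat \<Rightarrow> int" and e h f :: "nat \<Rightarrow> 'a"
  assumes simple: simple and chevalley: "chevalley_generators r A e h f"
begin

lemma
  assumes "i < r" "j < r"
  shows hh: "bracket (h i) (h j) = 0"
    and he: "bracket (h i) (e j) = scale (of_int (A i j)) (e j)"
    and hf: "bracket (h i) (f j) = scale (- of_int (A i j)) (f j)"
    and ef: "bracket (e i) (f j) = (if i = j then h i else 0)"
    and fe: "bracket (f i) (e j) = (if i = j then - h i else 0)"
  using chevalley assms bracket_commute [of "f i" "e j"] by (auto simp: chevalley_generators_def)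

lemma inj_h: "inj_on h {..<r}" and independent_h: "independent (h ` {..<r})"
  using chevalley by (auto simp: chevalley_generators_def)

lemma h_nonzero: "i < r \<Longrightarrow> h i \<noteq> 0"
  using independent_h dependent_zero by force

lemma generated:
  assumes "subspace S" "\<And>x y. x \<in> S \<Longrightarrow> y \<in> S \<Longrightarrow> bracket x y \<in> S"
    and "\<And>i. i < r \<Longrightarrow> e i \<in> S" "\<And>i. i < r \<Longrightarrow> f i \<in> S"
  shows "x \<in> S"
proof -
  have "subalgebra S \<and> e ` {..<r} \<subseteq> S \<and> f ` {..<r} \<subseteq> S"
    using assms by (auto simp: subalgebra_def)
  then show ?thesis
    using chevalley by (auto simp: chevalley_generators_def)
qed

text \<open>By the Jacobi identity the centralizer of \<open>x\<close> is a subalgebra; containing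
  the generators, it is everything, and the center is trivial.\<close>

lemma commutes_with_generators_eq_0:
  assumes "\<And>i. i < r \<Longrightarrow> bracket x (e i) = 0" "\<And>i. i < r \<Longrightarrow> bracket x (f i) = 0"
  shows "x = 0"
proof (rule simple_center_trivial [OF simple])
  fix y
  have closed: "bracket x (bracket y z) = 0" if "bracket x y = 0" "bracket x z = 0" for y z
    using bracket_bracket_left [of x y z] that by simp
  have "y \<in> {y. bracket x y = 0}"
    by (rule generated [OF subspace_centralizer]) (simp_all add: assms closed)
  then show "bracket x y = 0"
    by simp
qed

lemma span_h_eq:
  assumes "x \<in> span (h ` {..<r})"
  obtains c where "x = (\<Sum>i<r. scale (c i) (h i))"
proof -
  obtain c where "x = (\<Sum>v\<in>h ` {..<r}. scale (c v) v)"
    using assms unfolding span_finite [OF finite_imageI [OF finite_lessThan]] by blast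
  then show ?thesis
    using that [of "\<lambda>i. c (h i)"] by (simp add: sum.reindex [OF inj_h])
qed

lemma sum_h_eq_0:
  assumes "(\<Sum>i<r. scale (c i) (h i)) = 0" "i < r"
  shows "c i = 0"
proof -
  have "(\<Sum>v\<in>h ` {..<r}. scale (c (the_inv_into {..<r} h v)) v) = 0"
    using assms(1) by (simp add: sum.reindex [OF inj_h] the_inv_into_f_f [OF inj_h])
  then have "c (the_inv_into {..<r} h (h i)) = 0"
    using assms(2) by (intro independentD [OF independent_h, of "h ` {..<r}"]) auto
  then show ?thesis
    using assms(2) by (simp add: the_inv_into_f_f [OF inj_h])
qed

lemma bracket_sum_h:
  assumes "j < r"
  shows "bracket (\<Sum>i<r. scale (c i) (h i)) (e j) = scale (\<Sum>i<r. c i * of_int (A i j)) (e j)"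
    and "bracket (\<Sum>i<r. scale (c i) (h i)) (f j) = scale (- (\<Sum>i<r. c i * of_int (A i j))) (f j)"
  using assms by (simp_all add: bracket_sum_left he hf scale_sum_left sum_negf)

text \<open>Solvability of c A = (1, ..., 1). The resulting combination of the \<open>h i\<close>
  has eigenvalue 1 on every \<open>e j\<close> and so measures the height of roots.\<close>

lemma ex_grading_element:
  obtains c where "\<And>j. j < r \<Longrightarrow> (\<Sum>i<r. c i * of_int (A i j)) = (1 :: complex)"
proof -
  let ?B = "h ` {..<r}"
  interpret pair: vector_space_pair scale scale
    by unfold_locales
  \<comment> \<open>In coordinates with respect to the \<open>h i\<close>, \<open>g\<close> sends
    the row vector c to c A.\<close>
  obtain g where g: "Vector_Spaces.linear scale scale g"
    and g_B: "\<forall>x\<in>?B. g x = (\<Sum>j<r. scale (of_int (A (the_inv_into {..<r} h x) j)) (h j))"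
    using pair.linear_independent_extend [OF independent_h,
        of "\<lambda>x. \<Sum>j<r. scale (of_int (A (the_inv_into {..<r} h x) j)) (h j)"] by blast
  interpret g: Vector_Spaces.linear scale scale g by fact
  have g_h: "g (h i) = (\<Sum>j<r. scale (of_int (A i j)) (h j))" if "i < r" for i
    using that g_B by (simp add: the_inv_into_f_f [OF inj_h])
  have g_sum: "g (\<Sum>i<r. scale (c i) (h i)) = (\<Sum>j<r. scale (\<Sum>i<r. c i * of_int (A i j)) (h j))" for c
  proof -
    have "g (\<Sum>i<r. scale (c i) (h i)) = (\<Sum>i<r. \<Sum>j<r. scale (c i * of_int (A i j)) (h j))"
      by (simp add: g.sum g.scale g_h scale_sum_right)
    also have "\<dots> = (\<Sum>j<r. \<Sum>i<r. scale (c i * of_int (A i j)) (h j))"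
      by (rule sum.swap)
    finally show ?thesis
      by (simp add: scale_sum_left)
  qed
  \<comment> \<open>A kernel vector of the Cartan matrix gives a combination of the
    \<open>h i\<close> commuting with all generators.\<close>
  have "x = 0" if "x \<in> span ?B" "g x = 0" for x
  proof -
    obtain c where c: "x = (\<Sum>i<r. scale (c i) (h i))"
      using span_h_eq [OF \<open>x \<in> span ?B\<close>] by blast
    have zero: "(\<Sum>i<r. c i * of_int (A i j)) = 0" if "j < r" for j
      using sum_h_eq_0 [of "\<lambda>j. \<Sum>i<r. c i * of_int (A i j)" j] \<open>g x = 0\<close> that
      unfolding c g_sum by simp
    show "x = 0"
      unfolding c by (rule commutes_with_generators_eq_0) (simp_all add: bracket_sum_h zero)
  qed
  then have inj: "inj_on g (span ?B)"
    by (simp add: g.inj_on_iff_eq_0 subspace_span)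
  have "g ` ?B \<subseteq> span ?B"
    by (auto simp: g_h intro!: span_sum span_scale span_base [OF imageI])
  moreover have "independent (g ` ?B)"
    by (rule g.independent_injective_image [OF independent_h inj])
  \<comment> \<open>The images of the \<open>h i\<close> are independent and as many as the
    dimension, so they span and \<open>g\<close> is onto.\<close>
  moreover have "dim (span ?B) \<le> card (g ` ?B)"
    using inj_on_subset [OF inj span_superset]
    by (simp add: card_image dim_eq_card_independent independent_h)
  ultimately have "span ?B \<subseteq> g ` span ?B"
    using card_ge_dim_independent g.span_image by metis
  moreover have "(\<Sum>j<r. h j) \<in> span ?B"
    by (intro span_sum span_base) auto
  ultimately obtain x where x: "x \<in> span ?B" "g x = (\<Sum>j<r. h j)"
    by force
  obtain c where c: "x = (\<Sum>i<r. scale (c i) (h i))"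
    using span_h_eq [OF x(1)] by blast
  have "(\<Sum>j<r. scale ((\<Sum>i<r. c i * of_int (A i j)) - 1) (h j)) = 0"
    using x(2) unfolding c g_sum by (simp add: scale_left_diff_distrib sum_subtractf)
  from sum_h_eq_0 [OF this] that [of c] show ?thesis
    by simp
qed

lemma triangular_decomposition: "x \<in> span (ad_orbit r e \<union> ad_orbit r f \<union> h ` {..<r})"
proof -
  let ?T = "span (ad_orbit r e \<union> ad_orbit r f \<union> h ` {..<r})"
  have base: "x \<in> ?T" if "x \<in> ad_orbit r e \<or> x \<in> ad_orbit r f \<or> x \<in> h ` {..<r}" for x
    using that by (auto intro: span_base)
  have T: "bracket (e i) x \<in> ?T" "bracket (f i) x \<in> ?T" if "x \<in> ?T" "i < r" for i x
  proof -
    have 1: "bracket (f i) s \<in> ?T" if "s \<in> ad_orbit r e" for s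
    proof -
      \<comment> \<open>Since [f i, e i] = - h i, the negated \<open>h i\<close> are used here; in
        the opposite case the \<open>h i\<close> themselves appear.\<close>
      have "bracket (f i) s \<in> span (ad_orbit r e \<union> (\<lambda>i. - h i) ` {..<r})"
        by (rule ad_opposite_ad_orbit [OF that, where a = "\<lambda>i j. - of_int (A i j)"])
          (use \<open>i < r\<close> in \<open>auto simp: fe he\<close>)
      moreover have "span (ad_orbit r e \<union> (\<lambda>i. - h i) ` {..<r}) \<subseteq> ?T"
        by (intro span_minimal subspace_span) (auto intro: span_neg base)
      ultimately show ?thesis
        by blast
    qed
    have 2: "bracket (e i) s \<in> ?T" if "s \<in> ad_orbit r f" for s
    proof -
      have "bracket (e i) s \<in> span (ad_orbit r f \<union> h ` {..<r})"
        by (rule ad_opposite_ad_orbit [OF that, where a = "\<lambda>i j. - of_int (A i j)"])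
          (use \<open>i < r\<close> in \<open>auto simp: ef hf\<close>)
      moreover have "span (ad_orbit r f \<union> h ` {..<r}) \<subseteq> ?T"
        by (intro span_mono) auto
      ultimately show ?thesis
        by blast
    qed
    have 3: "bracket (e i) (h j) \<in> ?T" "bracket (f i) (h j) \<in> ?T" if "j < r" for j
      using that \<open>i < r\<close> bracket_commute [of "e i" "h j"] bracket_commute [of "f i" "h j"]
        base [of "e i"] base [of "f i"] ad_orbit.base [OF \<open>i < r\<close>]
      by (simp_all add: he hf span_neg span_scale)
    show "bracket (e i) x \<in> ?T"
      using \<open>i < r\<close> by (intro bracket_in_span [OF \<open>x \<in> ?T\<close>]) (auto intro: 2 3 base ad_orbit.step)
    show "bracket (f i) x \<in> ?T"
      using \<open>i < r\<close> by (intro bracket_in_span [OF \<open>x \<in> ?T\<close>]) (auto intro: 1 3 base ad_orbit.step)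
  qed
  \<comment> \<open>Elements whose adjoint action preserves \<open>?T\<close> form a subalgebra
    containing the generators, hence are all elements. So \<open>?T\<close> is an ideal containing
    the generators.\<close>
  have stable: "y \<in> {y. \<forall>x\<in>?T. bracket y x \<in> ?T}" for y
  proof (rule generated)
    show "subspace {y. \<forall>x\<in>?T. bracket y x \<in> ?T}"
      by (rule subspaceI) (auto intro: span_zero span_add span_scale)
  qed (simp_all add: T bracket_bracket_left span_diff)
  show ?thesis
    by (rule generated [OF subspace_span]) (use stable in \<open>simp_all add: base ad_orbit.base\<close>)
qed

end

section \<open>Orbit sums and the centralizer of the derived fixed-point algebra\<close>

locale simple_diagram_automorphism = simple_chevalley scale Basis bracket r A e h f
  for scale :: "complex \<Rightarrow> 'a::ab_group_add \<Rightarrow> 'a" and Basis bracket r A e h f +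
  fixes \<sigma> :: "'a \<Rightarrow> 'a" and p :: "nat \<Rightarrow> nat" and n :: nat
  assumes automorphism: "lie_automorphism \<sigma>"
    and p: "p permutes {..<r}"
    and sigma_gen: "i < r \<Longrightarrow> \<sigma> (e i) = e (p i)" "i < r \<Longrightarrow> \<sigma> (f i) = f (p i)"
    and n_pos: "n > 0" and sigma_n: "\<sigma> ^^ n = id"
begin

sublocale sigma: Vector_Spaces.linear scale scale \<sigma>
  using automorphism by (simp add: lie_automorphism_def)

lemma sigma_bracket: "\<sigma> (bracket x y) = bracket (\<sigma> x) (\<sigma> y)"
  using automorphism by (simp add: lie_automorphism_def)

text \<open>This is \<open>n\<close> times the projection onto the fixed points of \<sigma>; an
  orbit of length less than \<open>n\<close> is counted repeatedly.\<close>

definition orbit_sum where "orbit_sum x = (\<Sum>m<n. (\<sigma> ^^ m) x)"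

lemma sigma_power_scale: "(\<sigma> ^^ m) (scale c x) = scale c ((\<sigma> ^^ m) x)"
  by (induction m) (auto simp: sigma.scale)

lemma orbit_sum_scale: "orbit_sum (scale c x) = scale c (orbit_sum x)"
  by (simp add: orbit_sum_def sigma_power_scale scale_sum_right)

lemma sigma_power_sum: "(\<sigma> ^^ m) (sum g I) = (\<Sum>i\<in>I. (\<sigma> ^^ m) (g i))"
  by (induction m) (auto simp: sigma.sum)

lemma sigma_power_bracket: "(\<sigma> ^^ m) (bracket x y) = bracket ((\<sigma> ^^ m) x) ((\<sigma> ^^ m) y)"
  by (induction m) (auto simp: sigma_bracket)

lemma sigma_power_fixed: "\<sigma> x = x \<Longrightarrow> (\<sigma> ^^ m) x = x"
  by (induction m) auto

lemma p_less: "i < r \<Longrightarrow> (p ^^ m) i < r"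
  using permutes_in_image [OF p] by (induction m) auto

lemma sigma_power_gen: "i < r \<Longrightarrow> (\<sigma> ^^ m) (e i) = e ((p ^^ m) i)"
  "i < r \<Longrightarrow> (\<sigma> ^^ m) (f i) = f ((p ^^ m) i)"
  by (induction m) (auto simp: sigma_gen p_less)

lemma sigma_orbit_sum: "\<sigma> (orbit_sum x) = orbit_sum x"
proof -
  have "\<sigma> (orbit_sum x) = (\<Sum>m<n. (\<sigma> ^^ Suc m) x)"
    by (simp add: orbit_sum_def sigma.sum)
  \<comment> \<open>Adding the term for m = 0 gives n + 1 consecutive powers, the last of which is
    again \<open>x\<close>.\<close>
  also have "\<dots> + x = (\<Sum>m<Suc n. (\<sigma> ^^ m) x)"
    by (subst sum.lessThan_Suc_shift) (simp add: add.commute)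
  also have "\<dots> = orbit_sum x + x"
    by (simp add: orbit_sum_def sigma_n)
  finally show ?thesis
    by simp
qed

text \<open>Averaging is linear over the fixed-point algebra.\<close>

lemma orbit_sum_bracket: "\<sigma> x = x \<Longrightarrow> orbit_sum (bracket x y) = bracket x (orbit_sum y)"
  by (simp add: orbit_sum_def sigma_power_bracket sigma_power_fixed bracket_sum_right)

text \<open>The factor counts the stabilizer of i in the cyclic group generated by p.\<close>

lemma bracket_orbit_sum_e_f:
  assumes "i < r"
  shows "bracket (orbit_sum (e i)) (f i) = scale (of_nat (card {m \<in> {..<n}. (p ^^ m) i = i})) (h i)"
proof -
  have "bracket (orbit_sum (e i)) (f i) = (\<Sum>m<n. if (p ^^ m) i = i then h i else 0)"
    using assms by (auto simp: orbit_sum_def bracket_sum_left sigma_power_gen ef p_less intro!: sum.cong)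
  also have "\<dots> = (\<Sum>m\<in>{m \<in> {..<n}. (p ^^ m) i = i}. h i)"
    by (rule sum.inter_filter [symmetric]) simp
  finally show ?thesis
    by (simp add: sum_constant_scale)
qed

lemma stabilizer_card_nonzero: "of_nat (card {m \<in> {..<n}. (p ^^ m) i = i}) \<noteq> (0 :: complex)"
  unfolding of_nat_eq_0_iff using n_pos by (auto simp: card_eq_0_iff intro: exI [of _ 0])

lemma centralizer_derived_fixed_points:
  assumes u: "\<And>x y. \<sigma> x = x \<Longrightarrow> \<sigma> y = y \<Longrightarrow> bracket (bracket x y) u = 0"
  shows "u = 0"
proof -
  obtain c where c: "\<And>j. j < r \<Longrightarrow> (\<Sum>i<r. c i * of_int (A i j)) = (1 :: complex)"
    by (rule ex_grading_element) (rule that)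
  define H where "H = (\<Sum>i<r. scale (c i) (h i))"
  have He: "bracket H (e j) = e j" and Hf: "bracket H (f j) = - f j" if "j < r" for j
    using that by (simp_all add: H_def bracket_sum_h c)
  have fixed_H: "\<sigma> H = H"
  proof -
    have *: "bracket (\<sigma> H) (e j) = e j \<and> bracket (\<sigma> H) (f j) = - f j" if "j < r" for j
    proof -
      obtain i where i: "i < r" "j = p i"
        using permutes_image [OF p] \<open>j < r\<close> by (metis imageE lessThan_iff)
      then have "bracket (\<sigma> H) (e j) = \<sigma> (bracket H (e i))" "bracket (\<sigma> H) (f j) = \<sigma> (bracket H (f i))"
        by (simp_all add: sigma_gen sigma_bracket)
      then show ?thesis
        using i by (simp add: He Hf sigma_gen sigma.neg)
    qed
    have "\<sigma> H - H = 0"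
      by (rule commutes_with_generators_eq_0) (simp_all add: He Hf *)
    then show ?thesis
      by simp
  qed
  \<comment> \<open>The orbit sum equals its own bracket with H, hence is a bracket of fixed
    points.\<close>
  have tr_e: "bracket (orbit_sum (e i)) u = 0" if "i < r" for i
  proof -
    have "bracket H (orbit_sum (e i)) = orbit_sum (e i)"
      using orbit_sum_bracket [OF fixed_H, of "e i"] that by (simp add: He)
    then show ?thesis
      using u [OF fixed_H sigma_orbit_sum, of "e i"] by simp
  qed
  \<comment> \<open>Averaging the formula for [orbit sum of e i, f i] exhibits a nonzero multiple of
    the orbit sum of \<open>h i\<close> as a bracket of fixed points.\<close>
  have tr_h: "bracket (orbit_sum (h i)) u = 0" if "i < r" for i
  proof -
    let ?N = "of_nat (card {m \<in> {..<n}. (p ^^ m) i = i}) :: complex"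
    have "scale ?N (orbit_sum (h i)) = orbit_sum (bracket (orbit_sum (e i)) (f i))"
      using that by (simp add: bracket_orbit_sum_e_f orbit_sum_scale)
    also have "\<dots> = bracket (orbit_sum (e i)) (orbit_sum (f i))"
      by (intro orbit_sum_bracket sigma_orbit_sum)
    finally have "scale ?N (bracket (orbit_sum (h i)) u) = 0"
      by (metis bracket_scale(1) u sigma_orbit_sum)
    then show ?thesis
      unfolding scale_eq_0_iff using stabilizer_card_nonzero by blast
  qed
  \<comment> \<open>Averaging the fixed element H writes it through the orbit sums of the
    \<open>h i\<close>, all of which annihilate \<open>u\<close>.\<close>
  have "scale (of_nat n) H = orbit_sum H"
    by (simp add: orbit_sum_def sigma_power_fixed [OF fixed_H] sum_constant_scale)
  also have "\<dots> = (\<Sum>i<r. scale (c i) (orbit_sum (h i)))"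
    unfolding orbit_sum_def H_def sigma_power_sum sigma_power_scale
    by (subst sum.swap) (simp add: scale_sum_right)
  finally have "bracket (scale (of_nat n) H) u = (\<Sum>i<r. scale (c i) (bracket (orbit_sum (h i)) u))"
    by (simp add: bracket_sum_left)
  then have Hu: "bracket H u = 0"
    using n_pos tr_h by simp
  \<comment> \<open>H commutes with \<open>t\<close> and has eigenvalues plus or minus a positive
    length on the spanning vectors for \<open>q\<close>, so [H, u] = 0 forces q = 0.\<close>
  obtain q t where qt: "u = q + t" "q \<in> span (ad_orbit r e \<union> ad_orbit r f)" "t \<in> span (h ` {..<r})"
    using triangular_decomposition [of u] unfolding span_Un [of "ad_orbit r e \<union> ad_orbit r f"] by blast
  obtain d where d: "t = (\<Sum>i<r. scale (d i) (h i))"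
    using span_h_eq [OF qt(3)] by blast
  have "bracket H t = 0"
    unfolding H_def d by (simp add: bracket_sum_left bracket_sum_right hh)
  with Hu have "bracket H q = 0"
    by (simp add: qt(1))
  moreover have "\<exists>k. k \<noteq> 0 \<and> bracket H s = scale k s" if "s \<in> ad_orbit r e \<union> ad_orbit r f" for s
    using that
  proof
    assume "s \<in> ad_orbit r e"
    from ad_orbit_eigenvalue [OF this, of H 1] obtain m :: nat where "m > 0" "bracket H s = scale (of_nat m) s"
      by (auto simp: He)
    then show ?thesis
      by (intro exI [of _ "of_nat m"]) auto
  next
    assume "s \<in> ad_orbit r f"
    from ad_orbit_eigenvalue [OF this, of H "-1"] obtain m :: nat where "m > 0" "bracket H s = scale (- of_nat m) s"
      by (auto simp: Hf)
    then show ?thesis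
      by (intro exI [of _ "- of_nat m"]) auto
  qed
  ultimately have "q = 0"
    using linear_endo_eq_0_on_eigenvectors [OF linear_ad _ qt(2)] by blast
  then have u_eq: "u = (\<Sum>i<r. scale (d i) (h i))"
    using qt(1) d by simp
  \<comment> \<open>\<open>\<alpha> j\<close> is the value of the j-th simple root on
    \<open>u\<close>.\<close>
  define \<alpha> where "\<alpha> j = (\<Sum>i<r. d i * of_int (A i j))" for j
  have ue: "bracket u (e j) = scale (\<alpha> j) (e j)" and uf: "bracket u (f j) = scale (- \<alpha> j) (f j)" if "j < r" for j
    using that unfolding u_eq \<alpha>_def by (rule bracket_sum_h)+
  have \<alpha>: "\<alpha> j = 0" if "j < r" for j
  proof -
    \<comment> \<open>Two evaluations: the inner bracket is a multiple of \<open>h j\<close>, which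
      commutes with \<open>u\<close>; by the Leibniz rule \<open>u\<close> kills the orbit sum and
      scales \<open>f j\<close> by minus \<open>\<alpha> j\<close>.\<close>
    have "0 = bracket u (bracket (orbit_sum (e j)) (f j))"
      unfolding bracket_orbit_sum_e_f [OF that] u_eq using that by (simp add: bracket_sum_left hh)
    also have "\<dots> = bracket (bracket u (orbit_sum (e j))) (f j) + bracket (orbit_sum (e j)) (bracket u (f j))"
      by (simp add: bracket_bracket_left)
    also have "\<dots> = scale (- \<alpha> j) (bracket (orbit_sum (e j)) (f j))"
      using tr_e [OF that] uf [OF that] bracket_commute [of u "orbit_sum (e j)"] by simp
    also have "\<dots> = scale (- \<alpha> j * of_nat (card {m \<in> {..<n}. (p ^^ m) j = j})) (h j)"
      using bracket_orbit_sum_e_f [OF that] by simp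
    finally have "scale (- \<alpha> j * of_nat (card {m \<in> {..<n}. (p ^^ m) j = j})) (h j) = 0"
      by (rule sym)
    then show ?thesis
      unfolding scale_eq_0_iff mult_eq_0_iff neg_equal_0_iff_equal
      using h_nonzero [OF that] stabilizer_card_nonzero [of j] by blast
  qed
  show ?thesis
    by (rule commutes_with_generators_eq_0) (simp_all add: ue uf \<alpha>)
qed

end

section \<open>Affine gradings satisfy the axioms; conclusion\<close>

context finite_dimensional_lie_algebra
begin

lemma diagram_automorphism_centralizer_trivial:
  assumes "simple" "diagram_automorphism \<sigma>" "has_order \<sigma> n"
    and "\<And>x y. \<sigma> x = x \<Longrightarrow> \<sigma> y = y \<Longrightarrow> bracket (bracket x y) u = 0"
  shows "u = 0"
proof -
  obtain r A e h f p where
    "chevalley_generators r A e h f" "p permutes {..<r}" "\<forall>i<r. \<sigma> (e i) = e (p i) \<and> \<sigma> (f i) = f (p i)"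
    and "lie_automorphism \<sigma>"
    using assms(2) unfolding diagram_automorphism_def by blast
  then interpret simple_diagram_automorphism scale Basis bracket r A e h f \<sigma> p n
    using assms(1,3) by unfold_locales (auto simp: has_order_def)
  show ?thesis
    using assms(4) by (rule centralizer_derived_fixed_points)
qed

lemma simple_affine_grading:
  assumes "simple" "affine_grading n G"
  shows "graded_lie_algebra scale Basis bracket n G"
proof -
  have "n > 0 \<and> (\<forall>k. subspace (G k)) \<and>
      (\<forall>i j. \<forall>x\<in>G (i mod int n). \<forall>y\<in>G (j mod int n). bracket x y \<in> G ((i + j) mod int n)) \<and>
      (\<forall>u. (\<forall>x\<in>G 0. \<forall>y\<in>G 0. bracket (bracket x y) u = 0) \<longrightarrow> u = 0)"
    using assms(2) unfolding affine_grading_def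
  proof (elim disjE conjE exE)
    assume "n = 1" "\<forall>k. G k = UNIV"
    then show ?thesis
      using simple_centralizer_derived [OF assms(1)] by (simp add: subspace_UNIV)
  next
    fix \<sigma> assume n: "n \<in> {2, 3}" and \<sigma>: "diagram_automorphism \<sigma>" "has_order \<sigma> n"
      and G: "\<forall>k. G k = {x. \<sigma> x = scale (cis (2 * pi * of_int k / of_nat n)) x}"
    have "lie_automorphism \<sigma>"
      using \<sigma>(1) by (simp add: diagram_automorphism_def)
    then interpret \<sigma>: Vector_Spaces.linear scale scale \<sigma>
      by (simp add: lie_automorphism_def)
    have \<sigma>_bracket: "\<sigma> (bracket x y) = bracket (\<sigma> x) (\<sigma> y)" for x y
      using \<open>lie_automorphism \<sigma>\<close> by (simp add: lie_automorphism_def)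
    \<comment> \<open>\<open>\<chi>\<close> is a character of the integers, trivial on multiples of
      \<open>n\<close>: multiplicativity gives the grading property, and \<open>\<chi> 0 = 1\<close>
      makes \<open>G 0\<close> the fixed-point algebra.\<close>
    define \<chi> where "\<chi> k = cis (2 * pi * of_int k / of_nat n)" for k
    have G_iff: "x \<in> G k \<longleftrightarrow> \<sigma> x = scale (\<chi> k) x" for x k
      using G by (simp add: \<chi>_def)
    have \<chi>_add: "\<chi> (i + j) = \<chi> i * \<chi> j" for i j
      by (simp add: \<chi>_def cis_mult ring_distribs add_divide_distrib)
    have \<chi>_mult: "\<chi> (int n * k) = 1" for k
      using n cis_multiple_2pi [of "of_int k"] by (auto simp: \<chi>_def mult.assoc)
    have \<chi>_mod: "\<chi> (k mod int n) = \<chi> k" for k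
      using \<chi>_add [of "int n * (k div int n)" "k mod int n"] \<chi>_mult by simp
    have "subspace (G k)" for k
      by (rule subspaceI) (simp_all add: G_iff \<sigma>.add \<sigma>.scale scale_right_distrib mult.commute)
    moreover have "bracket x y \<in> G ((i + j) mod int n)" if "x \<in> G (i mod int n)" "y \<in> G (j mod int n)" for i j x y
      using that by (simp add: G_iff \<chi>_mod \<chi>_add \<sigma>_bracket mult.commute)
    moreover have "u = 0" if "\<forall>x\<in>G 0. \<forall>y\<in>G 0. bracket (bracket x y) u = 0" for u
      by (rule diagram_automorphism_centralizer_trivial [OF assms(1) \<sigma>])
        (use that in \<open>simp add: G_iff \<chi>_def\<close>)
    ultimately show ?thesis
      using n by auto
  qed
  note * = this
  \<comment> \<open>Were \<open>G 0\<close> zero, every vector would meet the centralizer premise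
    and vanish, contrary to a nonzero bracket.\<close>
  have "\<exists>x\<in>G 0. x \<noteq> 0"
  proof (rule ccontr)
    assume no: "\<not> (\<exists>x\<in>G 0. x \<noteq> 0)"
    obtain a b where "bracket a b \<noteq> 0"
      using assms(1) by (auto simp: simple_def)
    moreover have "\<forall>x\<in>G 0. \<forall>y\<in>G 0. bracket (bracket x y) (bracket a b) = 0"
      using no by auto
    ultimately show False
      using * by blast
  qed
  with * show ?thesis
    by unfold_locales blast+
qed

end

theorem theorem3:
  fixes scale :: "complex \<Rightarrow> 'a::ab_group_add \<Rightarrow> 'a"
    and Basis :: "'a set"
    and bracket :: "'a \<Rightarrow> 'a \<Rightarrow> 'a"
    and n :: nat
    and G :: "int \<Rightarrow> 'a set"
  assumes "finite_dimensional_lie_algebra scale Basis bracket"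
    and "lie_algebra.simple scale UNIV bracket"
    and "finite_dimensional_lie_algebra.affine_grading scale bracket n G"
  defines "L \<equiv> finite_dimensional_lie_algebra.affine_carrier n G"
    and "smult \<equiv> finite_dimensional_lie_algebra.affine_scale scale"
    and "lie \<equiv> finite_dimensional_lie_algebra.affine_bracket scale Basis bracket"
  shows "lie_algebra.hom_lie_structures smult L lie =
    lie_algebra.map_span smult
      (lie_algebra.central_hom_lie_structures smult L lie \<union> {lie_algebra.identity_map L})"
proof -
  interpret finite_dimensional_lie_algebra scale Basis bracket
    by fact
  interpret graded_lie_algebra scale Basis bracket n G
    by (rule simple_affine_grading) fact+
  show ?thesis
    unfolding L_def smult_def lie_def by (rule hom_lie_structures_affine)
qed

end
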